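(* Let $k$ be a field and let $M\xrightarrow{\sigma}P\xleftarrow{\tau}N$ be a quasi-coherent sheaf on $\mathbf{P}^1(k)$. For any integer $n$, $$\mathrm{Ext}^1(\mathcal{O}(n),\,M\xrightarrow{\sigma}P\xleftarrow{\tau}N)\cong P/(x^n\sigma(M)+\tau(N)),$$ so $\mathrm{Ext}^1(\mathcal{O}(n),\,M\xrightarrow{\sigma}P\xleftarrow{\tau}N)=0$ if and only if $x^n\sigma(M)+\tau(N)=P$.
   Context: The category $\mathfrak{Qco}(\mathbf{P}^1(k))$ is identified with the category of representations $M\xrightarrow{\sigma}P\xleftarrow{\tau}N$, where $M$ is a $k[x]$-module, $N$ a $k[x^{-1}]$-module, $P$ a $k[x,x^{-1}]$-module, $\sigma$ is $k[x]$-linear, $\tau$ is $k[x^{-1}]$-linear, and the induced maps $S^{-1}M\to S^{-1}P\cong P$ and $T^{-1}N\to T^{-1}P\cong P$ are isomorphisms of $k[x,x^{-1}]$-modules, with $S=\{1,x,x^2,\dots\}$ and $T=\{1,x^{-1},x^{-2},\dots\}$. Morphisms are triples of module maps commuting with the structure maps; kernels and cokernels are computed componentwise. For $n\in\mathbb{Z}$, $\mathcal{O}(n)$ is the representation $k[x]\to k[x,x^{-1}]\leftarrow k[x^{-1}]$ in which the left map is the inclusion ($1\mapsto 1$) and the right map is $k[x^{-1}]$-linear with $1\mapsto x^n$. $\mathrm{Ext}^1$ is taken in this category (equivalence classes of short exact sequences), and $\cong$ is isomorphism of abelian groups. *)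

theory Defs
  imports
    "HOL-Algebra.Module"
    "HOL-Algebra.AbelCoset"
    "HOL-Algebra.Elementary_Groups"
    "HOL-Library.Poly_Mapping"
    "HOL-Library.Equipollence"
begin

section \<open>The rings \<open>k[x]\<close>, \<open>k[x\<inverse>]\<close> and \<open>k[x,x\<inverse>]\<close>\<close>

text \<open>
  Laurent polynomials are the finitely supported functions from exponents to coefficients (with
  convolution as product); \<open>k[x]\<close> and \<open>k[x\<inverse>]\<close> are literally subrings.  Hence restricting
  a \<open>k[x,x\<inverse>]\<close>-module to one of them leaves the module record unchanged.
\<close>

type_synonym 'k laurent = "int \<Rightarrow>\<^sub>0 'k"

definition xpow :: "int \<Rightarrow> 'k::field laurent" where
  "xpow i = Poly_Mapping.single i 1"

definition laurent_ring :: "'k::field laurent ring" where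
  "laurent_ring = \<lparr>carrier = UNIV, mult = (*), one = 1, zero = 0, add = (+)\<rparr>"

definition poly_ring_x :: "'k::field laurent ring" where
  "poly_ring_x = laurent_ring\<lparr>carrier := {f. Poly_Mapping.keys f \<subseteq> {0..}}\<rparr>"

definition poly_ring_xinv :: "'k::field laurent ring" where
  "poly_ring_xinv = laurent_ring\<lparr>carrier := {f. Poly_Mapping.keys f \<subseteq> {..0}}\<rparr>"

definition powers_x :: "'k::field laurent set" where
  "powers_x = range (\<lambda>i::nat. xpow (int i))"

definition powers_xinv :: "'k::field laurent set" where
  "powers_xinv = range (\<lambda>i::nat. xpow (- int i))"


section \<open>Modules and their localisations\<close>

text \<open>
  Module records of HOL-Algebra carry a \<open>mult\<close> and a \<open>one\<close> that the locale \<^locale>\<open>module\<close>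
  ignores.
\<close>

definition mk_module ::
  "'b set \<Rightarrow> 'b \<Rightarrow> ('b \<Rightarrow> 'b \<Rightarrow> 'b) \<Rightarrow> ('r \<Rightarrow> 'b \<Rightarrow> 'b) \<Rightarrow> ('r, 'b) module" where
  "mk_module C z a s =
     \<lparr>carrier = C, mult = undefined, one = undefined, zero = z, add = a, smult = s\<rparr>"

definition mod_hom :: "'r ring \<Rightarrow> ('r, 'a) module \<Rightarrow> ('r, 'b) module \<Rightarrow> ('a \<Rightarrow> 'b) set" where
  "mod_hom R M N = {h \<in> hom (add_monoid M) (add_monoid N).
     \<forall>r\<in>carrier R. \<forall>m\<in>carrier M. h (r \<odot>\<^bsub>M\<^esub> m) = r \<odot>\<^bsub>N\<^esub> h m}"

definition mod_iso :: "'r ring \<Rightarrow> ('r, 'a) module \<Rightarrow> ('r, 'b) module \<Rightarrow> ('a \<Rightarrow> 'b) set" where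
  "mod_iso R M N = {h \<in> mod_hom R M N. bij_betw h (carrier M) (carrier N)}"

text \<open>The fraction \<open>m/s\<close>, as an equivalence class of pairs.\<close>

definition fraction ::
  "'k::field laurent set \<Rightarrow> ('k laurent, 'm) module \<Rightarrow> 'm \<Rightarrow> 'k laurent \<Rightarrow> ('m \<times> 'k laurent) set" where
  "fraction S M m s = {(m', s'). m' \<in> carrier M \<and> s' \<in> S \<and>
     (\<exists>u\<in>S. u \<odot>\<^bsub>M\<^esub> (s' \<odot>\<^bsub>M\<^esub> m) = u \<odot>\<^bsub>M\<^esub> (s \<odot>\<^bsub>M\<^esub> m'))}"

text \<open>
  \<open>S\<inverse>M\<close> for a module \<open>M\<close> over the subring \<open>R\<close>, where \<open>S \<subseteq> R\<close>.  It is a module over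
  \<open>S\<inverse>R \<subseteq> k[x,x\<inverse>]\<close>: if \<open>f = r/t\<close> with \<open>r = t f \<in> R\<close> and \<open>t \<in> S\<close>, then
  \<open>f (m/s) = (r m)/(t s)\<close>.  The unions run over all representatives.
\<close>

definition localisation ::
  "'k::field laurent ring \<Rightarrow> 'k laurent set \<Rightarrow> ('k laurent, 'm) module
    \<Rightarrow> ('k laurent, ('m \<times> 'k laurent) set) module" where
  "localisation R S M = mk_module
     {fraction S M m s | m s. m \<in> carrier M \<and> s \<in> S}
     (fraction S M \<zero>\<^bsub>M\<^esub> 1)
     (\<lambda>A B. \<Union>(m, s)\<in>A. \<Union>(m', s')\<in>B. fraction S M (s' \<odot>\<^bsub>M\<^esub> m \<oplus>\<^bsub>M\<^esub> s \<odot>\<^bsub>M\<^esub> m') (s * s'))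
     (\<lambda>f A. \<Union>(m, s)\<in>A. \<Union>t\<in>{t \<in> S. t * f \<in> carrier R}. fraction S M ((t * f) \<odot>\<^bsub>M\<^esub> m) (t * s))"

definition localised_map ::
  "'k::field laurent set \<Rightarrow> ('k laurent, 'p) module \<Rightarrow> ('m \<Rightarrow> 'p)
    \<Rightarrow> ('m \<times> 'k laurent) set \<Rightarrow> ('p \<times> 'k laurent) set" where
  "localised_map S P h A = (\<Union>(m, s)\<in>A. fraction S P (h m) s)"

text \<open>
  The composite \<open>S\<inverse>M \<rightarrow> S\<inverse>P \<cong> P\<close> for a \<open>k[x,x\<inverse>]\<close>-module \<open>P\<close>; the second map is the
  inverse of the canonical map \<open>p \<mapsto> p/1\<close>.
\<close>

definition induced_map ::
  "'k::field laurent set \<Rightarrow> ('k laurent, 'p) module \<Rightarrow> ('m \<Rightarrow> 'p) \<Rightarrow> ('m \<times> 'k laurent) set \<Rightarrow> 'p" where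
  "induced_map S P h = the_inv_into (carrier P) (\<lambda>p. fraction S P p 1) \<circ> localised_map S P h"


section \<open>Quasi-coherent sheaves on the projective line\<close>

record (overloaded) ('k, 'm, 'p, 'n) rep =
  lmod :: "('k::field laurent, 'm) module"
  cmod :: "('k laurent, 'p) module"
  rmod :: "('k laurent, 'n) module"
  sig :: "'m \<Rightarrow> 'p"
  tau :: "'n \<Rightarrow> 'p"

definition qcoh :: "('k::field, 'm, 'p, 'n) rep \<Rightarrow> bool" where
  "qcoh F \<longleftrightarrow>
     module poly_ring_x (lmod F) \<and>
     module laurent_ring (cmod F) \<and>
     module poly_ring_xinv (rmod F) \<and>
     sig F \<in> mod_hom poly_ring_x (lmod F) (cmod F) \<and>
     tau F \<in> mod_hom poly_ring_xinv (rmod F) (cmod F) \<and>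
     induced_map powers_x (cmod F) (sig F)
       \<in> mod_iso laurent_ring (localisation poly_ring_x powers_x (lmod F)) (cmod F) \<and>
     induced_map powers_xinv (cmod F) (tau F)
       \<in> mod_iso laurent_ring (localisation poly_ring_xinv powers_xinv (rmod F)) (cmod F)"

definition ring_as_module :: "'k::field laurent ring \<Rightarrow> ('k laurent, 'k laurent) module" where
  "ring_as_module R = mk_module (carrier R) 0 (+) (*)"

definition twist :: "int \<Rightarrow> ('k::field, 'k laurent, 'k laurent, 'k laurent) rep"
    (\<open>\<O>'(_')\<close>) where
  "twist n = \<lparr>lmod = ring_as_module poly_ring_x, cmod = ring_as_module laurent_ring,
     rmod = ring_as_module poly_ring_xinv, sig = (\<lambda>f. f), tau = (\<lambda>g. g * xpow n)\<rparr>"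

record ('m, 'p, 'n, 'a, 'b, 'c) rep_map =
  lfun :: "'m \<Rightarrow> 'a"
  cfun :: "'p \<Rightarrow> 'b"
  rfun :: "'n \<Rightarrow> 'c"

definition rep_hom ::
  "('k::field, 'm, 'p, 'n) rep \<Rightarrow> ('k, 'a, 'b, 'c) rep \<Rightarrow> ('m, 'p, 'n, 'a, 'b, 'c) rep_map set" where
  "rep_hom F G = {h.
     lfun h \<in> mod_hom poly_ring_x (lmod F) (lmod G) \<and>
     cfun h \<in> mod_hom laurent_ring (cmod F) (cmod G) \<and>
     rfun h \<in> mod_hom poly_ring_xinv (rmod F) (rmod G) \<and>
     (\<forall>m\<in>carrier (lmod F). cfun h (sig F m) = sig G (lfun h m)) \<and>
     (\<forall>m\<in>carrier (rmod F). cfun h (tau F m) = tau G (rfun h m))}"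

definition rep_iso ::
  "('k::field, 'm, 'p, 'n) rep \<Rightarrow> ('k, 'a, 'b, 'c) rep \<Rightarrow> ('m, 'p, 'n, 'a, 'b, 'c) rep_map set" where
  "rep_iso F G = {h \<in> rep_hom F G.
     bij_betw (lfun h) (carrier (lmod F)) (carrier (lmod G)) \<and>
     bij_betw (cfun h) (carrier (cmod F)) (carrier (cmod G)) \<and>
     bij_betw (rfun h) (carrier (rmod F)) (carrier (rmod G))}"


section \<open>Extensions\<close>

record (overloaded) ('k, 'm, 'p, 'n, 'a, 'b, 'c, 'q, 'r, 's) ext =
  mid :: "('k::field, 'a, 'b, 'c) rep"
  inc :: "('m, 'p, 'n, 'a, 'b, 'c) rep_map"
  prj :: "('a, 'b, 'c, 'q, 'r, 's) rep_map"

definition short_exact ::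
  "('r, 'm) module \<Rightarrow> ('m \<Rightarrow> 'a) \<Rightarrow> ('r, 'a) module \<Rightarrow> ('a \<Rightarrow> 'q) \<Rightarrow> ('r, 'q) module \<Rightarrow> bool" where
  "short_exact L i E p Q \<longleftrightarrow>
     inj_on i (carrier L) \<and>
     i ` carrier L = {e \<in> carrier E. p e = \<zero>\<^bsub>Q\<^esub>} \<and>
     p ` carrier E = carrier Q"

text \<open>\<open>is_ext G F Z\<close>: \<open>Z\<close> is a short exact sequence \<open>0 \<rightarrow> F \<rightarrow> mid Z \<rightarrow> G \<rightarrow> 0\<close> of sheaves.\<close>

definition is_ext ::
  "('k::field, 'q, 'r, 's) rep \<Rightarrow> ('k, 'm, 'p, 'n) rep
    \<Rightarrow> ('k, 'm, 'p, 'n, 'a, 'b, 'c, 'q, 'r, 's) ext \<Rightarrow> bool" where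
  "is_ext G F Z \<longleftrightarrow>
     qcoh (mid Z) \<and> inc Z \<in> rep_hom F (mid Z) \<and> prj Z \<in> rep_hom (mid Z) G \<and>
     short_exact (lmod F) (lfun (inc Z)) (lmod (mid Z)) (lfun (prj Z)) (lmod G) \<and>
     short_exact (cmod F) (cfun (inc Z)) (cmod (mid Z)) (cfun (prj Z)) (cmod G) \<and>
     short_exact (rmod F) (rfun (inc Z)) (rmod (mid Z)) (rfun (prj Z)) (rmod G)"

text \<open>
  Equivalence of extensions: an isomorphism of the middle terms inducing the identity on both
  ends.  The middle terms may have different types.
\<close>

definition ext_equiv ::
  "('k::field, 'm, 'p, 'n) rep
    \<Rightarrow> ('k, 'm, 'p, 'n, 'a, 'b, 'c, 'q, 'r, 's) ext
    \<Rightarrow> ('k, 'm, 'p, 'n, 'd, 'e, 'f, 'q, 'r, 's) ext \<Rightarrow> bool" where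
  "ext_equiv F Z W \<longleftrightarrow> (\<exists>h\<in>rep_iso (mid Z) (mid W).
     (\<forall>m\<in>carrier (lmod F). lfun h (lfun (inc Z) m) = lfun (inc W) m) \<and>
     (\<forall>m\<in>carrier (cmod F). cfun h (cfun (inc Z) m) = cfun (inc W) m) \<and>
     (\<forall>m\<in>carrier (rmod F). rfun h (rfun (inc Z) m) = rfun (inc W) m) \<and>
     (\<forall>e\<in>carrier (lmod (mid Z)). lfun (prj W) (lfun h e) = lfun (prj Z) e) \<and>
     (\<forall>e\<in>carrier (cmod (mid Z)). cfun (prj W) (cfun h e) = cfun (prj Z) e) \<and>
     (\<forall>e\<in>carrier (rmod (mid Z)). rfun (prj W) (rfun h e) = rfun (prj Z) e))"

text \<open>The split extension \<open>0 \<rightarrow> F \<rightarrow> F \<oplus> G \<rightarrow> G \<rightarrow> 0\<close>.\<close>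

definition dsum_mod :: "('r, 'a) module \<Rightarrow> ('r, 'b) module \<Rightarrow> ('r, 'a \<times> 'b) module" where
  "dsum_mod M N = mk_module (carrier M \<times> carrier N) (\<zero>\<^bsub>M\<^esub>, \<zero>\<^bsub>N\<^esub>)
     (\<lambda>(a, b) (a', b'). (a \<oplus>\<^bsub>M\<^esub> a', b \<oplus>\<^bsub>N\<^esub> b'))
     (\<lambda>r (a, b). (r \<odot>\<^bsub>M\<^esub> a, r \<odot>\<^bsub>N\<^esub> b))"

definition dsum_rep ::
  "('k::field, 'm, 'p, 'n) rep \<Rightarrow> ('k, 'q, 'r, 's) rep \<Rightarrow> ('k, 'm \<times> 'q, 'p \<times> 'r, 'n \<times> 's) rep" where
  "dsum_rep F G = \<lparr>lmod = dsum_mod (lmod F) (lmod G), cmod = dsum_mod (cmod F) (cmod G),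
     rmod = dsum_mod (rmod F) (rmod G),
     sig = map_prod (sig F) (sig G), tau = map_prod (tau F) (tau G)\<rparr>"

definition split_ext ::
  "('k::field, 'q, 'r, 's) rep \<Rightarrow> ('k, 'm, 'p, 'n) rep
    \<Rightarrow> ('k, 'm, 'p, 'n, 'm \<times> 'q, 'p \<times> 'r, 'n \<times> 's, 'q, 'r, 's) ext" where
  "split_ext G F = \<lparr>mid = dsum_rep F G,
     inc = \<lparr>lfun = (\<lambda>m. (m, \<zero>\<^bsub>lmod G\<^esub>)), cfun = (\<lambda>m. (m, \<zero>\<^bsub>cmod G\<^esub>)),
            rfun = (\<lambda>m. (m, \<zero>\<^bsub>rmod G\<^esub>))\<rparr>,
     prj = \<lparr>lfun = snd, cfun = snd, rfun = snd\<rparr>\<rparr>"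

text \<open>
  The Baer sum of \<open>0 \<rightarrow> L \<rightarrow> E \<rightarrow> Q \<rightarrow> 0\<close> and \<open>0 \<rightarrow> L \<rightarrow> E' \<rightarrow> Q \<rightarrow> 0\<close> has middle term
  \<open>{(e, e'). p e = p' e'} / {(i m, - i' m) | m \<in> L}\<close>.
\<close>

definition baer_class ::
  "('r, 'm) module \<Rightarrow> ('m \<Rightarrow> 'a) \<Rightarrow> ('r, 'a) module \<Rightarrow> ('m \<Rightarrow> 'b) \<Rightarrow> ('r, 'b) module
    \<Rightarrow> 'a \<Rightarrow> 'b \<Rightarrow> ('a \<times> 'b) set" where
  "baer_class L i E i' E' e e' = (\<lambda>m. (e \<oplus>\<^bsub>E\<^esub> i m, e' \<ominus>\<^bsub>E'\<^esub> i' m)) ` carrier L"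

definition baer_mod ::
  "('r, 'm) module \<Rightarrow> ('m \<Rightarrow> 'a) \<Rightarrow> ('r, 'a) module \<Rightarrow> ('a \<Rightarrow> 'q)
    \<Rightarrow> ('m \<Rightarrow> 'b) \<Rightarrow> ('r, 'b) module \<Rightarrow> ('b \<Rightarrow> 'q) \<Rightarrow> ('r, ('a \<times> 'b) set) module" where
  "baer_mod L i E p i' E' p' = mk_module
     {baer_class L i E i' E' e e' | e e'. e \<in> carrier E \<and> e' \<in> carrier E' \<and> p e = p' e'}
     (baer_class L i E i' E' \<zero>\<^bsub>E\<^esub> \<zero>\<^bsub>E'\<^esub>)
     (\<lambda>A B. \<Union>(e, e')\<in>A. \<Union>(f, f')\<in>B. baer_class L i E i' E' (e \<oplus>\<^bsub>E\<^esub> f) (e' \<oplus>\<^bsub>E'\<^esub> f'))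
     (\<lambda>r A. \<Union>(e, e')\<in>A. baer_class L i E i' E' (r \<odot>\<^bsub>E\<^esub> e) (r \<odot>\<^bsub>E'\<^esub> e'))"

definition baer_rep ::
  "('k::field, 'm, 'p, 'n) rep
    \<Rightarrow> ('k, 'm, 'p, 'n, 'a, 'b, 'c, 'q, 'r, 's) ext
    \<Rightarrow> ('k, 'm, 'p, 'n, 'd, 'e, 'f, 'q, 'r, 's) ext
    \<Rightarrow> ('k, ('a \<times> 'd) set, ('b \<times> 'e) set, ('c \<times> 'f) set) rep" where
  "baer_rep F Z W = \<lparr>
     lmod = baer_mod (lmod F) (lfun (inc Z)) (lmod (mid Z)) (lfun (prj Z))
              (lfun (inc W)) (lmod (mid W)) (lfun (prj W)),
     cmod = baer_mod (cmod F) (cfun (inc Z)) (cmod (mid Z)) (cfun (prj Z))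
              (cfun (inc W)) (cmod (mid W)) (cfun (prj W)),
     rmod = baer_mod (rmod F) (rfun (inc Z)) (rmod (mid Z)) (rfun (prj Z))
              (rfun (inc W)) (rmod (mid W)) (rfun (prj W)),
     sig = (\<lambda>A. \<Union>(e, e')\<in>A. baer_class (cmod F) (cfun (inc Z)) (cmod (mid Z))
              (cfun (inc W)) (cmod (mid W)) (sig (mid Z) e) (sig (mid W) e')),
     tau = (\<lambda>A. \<Union>(e, e')\<in>A. baer_class (cmod F) (cfun (inc Z)) (cmod (mid Z))
              (cfun (inc W)) (cmod (mid W)) (tau (mid Z) e) (tau (mid W) e'))\<rparr>"

definition baer_sum ::
  "('k::field, 'm, 'p, 'n) rep
    \<Rightarrow> ('k, 'm, 'p, 'n, 'a, 'b, 'c, 'q, 'r, 's) ext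
    \<Rightarrow> ('k, 'm, 'p, 'n, 'd, 'e, 'f, 'q, 'r, 's) ext
    \<Rightarrow> ('k, 'm, 'p, 'n, ('a \<times> 'd) set, ('b \<times> 'e) set, ('c \<times> 'f) set, 'q, 'r, 's) ext" where
  "baer_sum F Z W = \<lparr>
     mid = baer_rep F Z W,
     inc = \<lparr>
       lfun = (\<lambda>m. baer_class (lmod F) (lfun (inc Z)) (lmod (mid Z)) (lfun (inc W)) (lmod (mid W))
                (lfun (inc Z) m) \<zero>\<^bsub>lmod (mid W)\<^esub>),
       cfun = (\<lambda>m. baer_class (cmod F) (cfun (inc Z)) (cmod (mid Z)) (cfun (inc W)) (cmod (mid W))
                (cfun (inc Z) m) \<zero>\<^bsub>cmod (mid W)\<^esub>),
       rfun = (\<lambda>m. baer_class (rmod F) (rfun (inc Z)) (rmod (mid Z)) (rfun (inc W)) (rmod (mid W))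
                (rfun (inc Z) m) \<zero>\<^bsub>rmod (mid W)\<^esub>)\<rparr>,
     prj = \<lparr>
       lfun = (\<lambda>A. the_elem ((\<lambda>(e, e'). lfun (prj Z) e) ` A)),
       cfun = (\<lambda>A. the_elem ((\<lambda>(e, e'). cfun (prj Z) e) ` A)),
       rfun = (\<lambda>A. the_elem ((\<lambda>(e, e'). rfun (prj Z) e) ` A))\<rparr>\<rparr>"

text \<open>
  The class of all extensions forms no set, so the middle terms are taken with carriers inside
  fixed types \<open>'a\<close>, \<open>'b\<close>, \<open>'c\<close>.  The sequence \<open>Z\<close> whose class is taken may
  have a middle term of other types (as the split extension and the Baer sum do).
\<close>

definition ext_class ::
  "('k::field, 'q, 'r, 's) rep \<Rightarrow> ('k, 'm, 'p, 'n) rep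
    \<Rightarrow> ('k, 'm, 'p, 'n, 'd, 'e, 'f, 'q, 'r, 's) ext
    \<Rightarrow> ('k, 'm, 'p, 'n, 'a, 'b, 'c, 'q, 'r, 's) ext set" where
  "ext_class G F Z = {W. is_ext G F W \<and> ext_equiv F W Z}"

text \<open>
  \<open>Ext\<^sup>1(G, F)\<close> under Baer sum, written as a (multiplicative) HOL-Algebra group.  In every
  component the middle term of an extension is in bijection with the product of the two ends.
  Thus, if the types \<open>'a\<close>, \<open>'b\<close>, \<open>'c\<close> are at least as large as these products, then
  every extension, of whatever types, is equivalent to one counted here.
\<close>

definition Ext1 ::
  "('a \<times> 'b \<times> 'c) itself \<Rightarrow> ('k::field, 'q, 'r, 's) rep \<Rightarrow> ('k, 'm, 'p, 'n) rep
    \<Rightarrow> ('k, 'm, 'p, 'n, 'a, 'b, 'c, 'q, 'r, 's) ext set monoid" where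
  "Ext1 U G F = \<lparr>
     carrier = {ext_class G F Z | Z :: ('k, 'm, 'p, 'n, 'a, 'b, 'c, 'q, 'r, 's) ext. is_ext G F Z},
     mult = (\<lambda>A B. \<Union>Z\<in>A. \<Union>W\<in>B. ext_class G F (baer_sum F Z W)),
     one = ext_class G F (split_ext G F)\<rparr>"

end

theory Submission
  imports Defs
begin

text \<open>
  Let \<open>0 \<rightarrow> F \<rightarrow> E \<rightarrow> \<O>(n) \<rightarrow> 0\<close> be an extension, with \<open>F = (M \<rightarrow> P \<leftarrow> N)\<close>.  In each of the three components
  the right-hand end is a free module of rank one, so the sequence of modules splits as soon as a
  lift of \<open>1\<close> is chosen.  All the information therefore lies in how the splittings fit together.
  Choose a lift \<open>a\<close> of \<open>1\<close> in the \<open>k[x]\<close>-component and a lift \<open>b\<close> of \<open>1\<close> in the \<open>k[x\<inverse>]\<close>-component.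
  Both \<open>\<tau> b\<close> and \<open>x\<^sup>n \<sigma> a\<close> lie over \<open>x\<^sup>n\<close>, so they differ by an element \<open>p\<close> of \<open>P\<close>.  Changing \<open>a\<close> by \<open>m \<in> M\<close> and \<open>b\<close>
  by \<open>m' \<in> N\<close> changes \<open>p\<close> by \<open>\<tau> m' - x\<^sup>n \<sigma> m\<close>, so \<open>p\<close> is well defined in \<open>P/(x\<^sup>n \<sigma>(M) + \<tau>(N))\<close>.  The set of all
  these \<open>p\<close> is a coset, called the gluing class of the extension here.

  The gluing class is a complete invariant.  If two extensions admit the same \<open>p\<close>, the isomorphisms
  of the components that match the chosen lifts commute with \<open>\<sigma>\<close> because \<open>\<sigma> a\<close> is used as the lift of \<open>1\<close>
  in the middle component, and with \<open>\<tau>\<close> because \<open>p\<close> is the same (lemma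
  \<open>ext_equiv_iff_gluing_class\<close>).  Every \<open>p\<close> occurs: twist the right-hand map of the split extension to
  \<open>(m, g) \<mapsto> (\<tau> m + g p, g x\<^sup>n)\<close> (lemma \<open>glued_ext_gluing_class\<close>), and move the result into the
  prescribed types (lemma \<open>gluing_class_surj\<close>).  Finally the pairs of lifts represent
  lifts in the Baer sum, and \<open>[i p, i' q] = [i (p + q), 0]\<close> there, so gluing classes add up (lemma
  \<open>baer_sum_twist_extension\<close>).  Hence sending a coset to the set of extensions with that gluing class is
  an isomorphism from \<open>P/(x\<^sup>n \<sigma>(M) + \<tau>(N))\<close> onto the group of extensions; in particular the latter is an
  abelian group, which is obtained by transport of structure instead of from the Baer sum directly.

  Two facts keep the category of sheaves under control.  The condition that \<open>S\<inverse>M \<rightarrow> P\<close> is an isomorphism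
  amounts to two statements about elements that mention no fractions (lemma \<open>qcoh_iff\<close>), and
  in this form it passes from the ends of a short exact sequence to its middle (lemma
  \<open>local_iso_extension\<close>).  So the middle terms constructed below are
  quasi-coherent as soon as they are representations that sit in exact sequences.
\<close>

section \<open>Modules over subrings of the Laurent polynomials\<close>

lemma (in abelian_group) minus_eq_zero_iff:
  assumes "a \<in> carrier G" "b \<in> carrier G"
  shows "a \<ominus> b = \<zero> \<longleftrightarrow> a = b"
  using assms by (metis a_minus_def add.inv_closed minus_equality r_neg minus_minus)

lemma mod_homD:
  assumes "h \<in> mod_hom R M N"
  shows mod_hom_closed: "m \<in> carrier M \<Longrightarrow> h m \<in> carrier N"
    and mod_hom_add: "m \<in> carrier M \<Longrightarrow> m' \<in> carrier M \<Longrightarrow> h (m \<oplus>\<^bsub>M\<^esub> m') = h m \<oplus>\<^bsub>N\<^esub> h m'"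
    and mod_hom_smult: "r \<in> carrier R \<Longrightarrow> m \<in> carrier M \<Longrightarrow> h (r \<odot>\<^bsub>M\<^esub> m) = r \<odot>\<^bsub>N\<^esub> h m"
  using assms by (auto simp: mod_hom_def hom_def)

lemma mod_homI:
  assumes "\<And>m. m \<in> carrier M \<Longrightarrow> h m \<in> carrier N"
    and "\<And>m m'. m \<in> carrier M \<Longrightarrow> m' \<in> carrier M \<Longrightarrow> h (m \<oplus>\<^bsub>M\<^esub> m') = h m \<oplus>\<^bsub>N\<^esub> h m'"
    and "\<And>r m. r \<in> carrier R \<Longrightarrow> m \<in> carrier M \<Longrightarrow> h (r \<odot>\<^bsub>M\<^esub> m) = r \<odot>\<^bsub>N\<^esub> h m"
  shows "h \<in> mod_hom R M N"
  using assms by (auto simp: mod_hom_def hom_def)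

lemma mod_hom_group_hom:
  assumes "h \<in> mod_hom R M N" "abelian_group M" "abelian_group N"
  shows "group_hom (add_monoid M) (add_monoid N) h"
  using assms by (auto simp: mod_hom_def group_hom_def group_hom_axioms_def
      intro: abelian_group.a_group)

lemma mod_hom_zero:
  assumes "h \<in> mod_hom R M N" "abelian_group M" "abelian_group N"
  shows "h \<zero>\<^bsub>M\<^esub> = \<zero>\<^bsub>N\<^esub>"
  using group_hom.hom_one[OF mod_hom_group_hom[OF assms]] by simp

lemma mod_hom_a_inv:
  assumes "h \<in> mod_hom R M N" "abelian_group M" "abelian_group N" "m \<in> carrier M"
  shows "h (\<ominus>\<^bsub>M\<^esub> m) = \<ominus>\<^bsub>N\<^esub> h m"
  using group_hom.hom_inv[OF mod_hom_group_hom[OF assms(1-3)]] assms(4)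
  by (simp add: a_inv_def)

lemma mod_hom_a_minus:
  assumes "h \<in> mod_hom R M N" "abelian_group M" "abelian_group N" "m \<in> carrier M" "m' \<in> carrier M"
  shows "h (m \<ominus>\<^bsub>M\<^esub> m') = h m \<ominus>\<^bsub>N\<^esub> h m'"
  using assms by (simp add: a_minus_def mod_hom_add mod_hom_a_inv abelian_group.a_inv_closed)

lemma mk_module_simps [simp]:
  "carrier (mk_module C z a s) = C" "zero (mk_module C z a s) = z"
  "add (mk_module C z a s) = a" "smult (mk_module C z a s) = s"
  by (simp_all add: mk_module_def)

lemma laurent_ring_simps [simp]:
  "carrier laurent_ring = UNIV" "mult laurent_ring = (*)" "one laurent_ring = 1"
  "zero laurent_ring = 0" "add laurent_ring = (+)"
  by (simp_all add: laurent_ring_def)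

lemma ring_as_module_simps [simp]:
  "carrier (ring_as_module R) = carrier R" "zero (ring_as_module R) = 0"
  "add (ring_as_module R) = (+)" "smult (ring_as_module R) = (*)"
  by (simp_all add: ring_as_module_def)

text \<open>
  The equation for \<open>R\<close> fixes all ring operations, so \<open>k[x]\<close>, \<open>k[x\<inverse>]\<close> and \<open>k[x,x\<inverse>]\<close> can be
  treated at once and a \<open>k[x,x\<inverse>]\<close>-module is a module over each of them.
\<close>

locale laurent_subring =
  fixes R :: "'k::field laurent ring"
  assumes restricted: "R = laurent_ring\<lparr>carrier := carrier R\<rparr>"
    and one_mem: "1 \<in> carrier R"
    and add_mem: "f \<in> carrier R \<Longrightarrow> g \<in> carrier R \<Longrightarrow> f + g \<in> carrier R"
    and mult_mem: "f \<in> carrier R \<Longrightarrow> g \<in> carrier R \<Longrightarrow> f * g \<in> carrier R"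
    and uminus_mem: "f \<in> carrier R \<Longrightarrow> - f \<in> carrier R"
begin

lemma subring_simps [simp]:
  "mult R = (*)" "one R = 1" "zero R = 0" "add R = (+)"
  by (subst restricted, simp)+

lemma zero_mem: "0 \<in> carrier R"
  using add_mem[OF one_mem uminus_mem[OF one_mem]] by simp

lemma subring_cring: "cring R"
proof (rule cringI)
  show "abelian_group R"
    by (rule abelian_groupI)
      (auto simp: add_mem zero_mem algebra_simps intro!: bexI[of _ "- x" for x] uminus_mem)
  show "Group.comm_monoid R"
    by (rule comm_monoidI) (auto simp: mult_mem one_mem algebra_simps)
qed (auto simp: algebra_simps)

lemma ring_as_module_abelian: "abelian_group (ring_as_module R)"
  by (rule abelian_groupI)
    (auto simp: add_mem zero_mem algebra_simps intro!: bexI[of _ "- x" for x] uminus_mem)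

lemma ring_as_module_module: "module R (ring_as_module R)"
  by (rule moduleI[OF subring_cring ring_as_module_abelian])
    (auto simp: mult_mem algebra_simps)

lemma restrict_module:
  assumes "module laurent_ring P"
  shows "module R P"
proof -
  interpret module laurent_ring P by fact
  show ?thesis
    by (rule moduleI[OF subring_cring M.abelian_group_axioms])
      (use smult_l_distr smult_r_distr smult_assoc1 smult_one in auto)
qed

lemma restrict_mod_hom: "h \<in> mod_hom laurent_ring P Q \<Longrightarrow> h \<in> mod_hom R P Q"
  by (auto simp: mod_hom_def)

end

text \<open>
  The elements of \<open>S\<close> are invertible Laurent polynomials and can be used to clear denominators:
  \<open>S\<inverse>R = k[x,x\<inverse>]\<close>.
\<close>

locale denominators = laurent_subring R
  for R :: "'k::field laurent ring" +
  fixes S :: "'k laurent set"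
  assumes denom_mem: "S \<subseteq> carrier R"
    and denom_one: "1 \<in> S"
    and denom_mult: "s \<in> S \<Longrightarrow> t \<in> S \<Longrightarrow> s * t \<in> S"
    and denom_unit: "s \<in> S \<Longrightarrow> \<exists>v. v * s = 1"
    and clear_denom: "\<exists>t\<in>S. t * f \<in> carrier R"

lemma laurent_subring_laurent: "laurent_subring laurent_ring"
  by unfold_locales simp_all

lemma xpow_add: "xpow (i + j) = xpow i * xpow j"
  by (simp add: xpow_def mult_single)

lemma xpow_0: "xpow 0 = 1"
  by (simp add: xpow_def)

lemma keys_xpow_mult: "Poly_Mapping.keys (xpow i * f) \<subseteq> (+) i ` Poly_Mapping.keys f"
  using keys_mult[of "xpow i" f] by (auto simp: xpow_def split: if_splits)

lemma keys_bounded: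
  fixes f :: "'k::field laurent"
  obtains b :: nat where "Poly_Mapping.keys f \<subseteq> {- int b..int b}"
proof -
  obtain c where c: "\<And>i. i \<in> Poly_Mapping.keys f \<Longrightarrow> \<bar>i\<bar> \<le> c"
    using finite_keys[of f] bdd_above_finite[of "abs ` Poly_Mapping.keys f"]
    by (auto simp: bdd_above_def)
  have "Poly_Mapping.keys f \<subseteq> {- int (nat c)..int (nat c)}"
    using c by force
  then show ?thesis by (rule that)
qed

interpretation poly_x: denominators "poly_ring_x :: 'k::field laurent ring" powers_x
proof
  fix f :: "'k laurent"
  obtain b where "Poly_Mapping.keys f \<subseteq> {- int b..int b}" by (rule keys_bounded)
  then have "xpow (int b) * f \<in> carrier poly_ring_x"
    using keys_xpow_mult[of "int b" f] by (force simp: poly_ring_x_def)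
  then show "\<exists>t\<in>powers_x. t * f \<in> carrier poly_ring_x"
    by (auto simp: powers_x_def)
next
  fix s t :: "'k laurent"
  assume "s \<in> powers_x"
  then obtain i where i: "s = xpow (int i)" by (auto simp: powers_x_def)
  have "xpow (- int i) * s = 1" by (simp add: i xpow_0 flip: xpow_add)
  then show "\<exists>v. v * s = 1" ..
  assume "t \<in> powers_x"
  with i show "s * t \<in> powers_x" by (auto simp: powers_x_def simp flip: xpow_add of_nat_add)
next
  show "1 \<in> (powers_x :: 'k laurent set)"
    by (auto simp: powers_x_def simp flip: xpow_0 intro!: image_eqI[of _ _ 0])
next
  fix f g :: "'k laurent"
  assume "f \<in> carrier poly_ring_x" "g \<in> carrier poly_ring_x"
  then show "f + g \<in> carrier poly_ring_x" "f * g \<in> carrier poly_ring_x"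
    using keys_mult[of f g] Poly_Mapping.keys_add[of f g] 
    by (force simp: poly_ring_x_def)+
qed (auto simp: poly_ring_x_def powers_x_def xpow_def)

interpretation poly_xinv: denominators "poly_ring_xinv :: 'k::field laurent ring" powers_xinv
proof
  fix f :: "'k laurent"
  obtain b where "Poly_Mapping.keys f \<subseteq> {- int b..int b}" by (rule keys_bounded)
  then have "xpow (- int b) * f \<in> carrier poly_ring_xinv"
    using keys_xpow_mult[of "- int b" f] by (force simp: poly_ring_xinv_def)
  then show "\<exists>t\<in>powers_xinv. t * f \<in> carrier poly_ring_xinv"
    by (auto simp: powers_xinv_def)
next
  fix s t :: "'k laurent"
  assume "s \<in> powers_xinv"
  then obtain i where i: "s = xpow (- int i)" by (auto simp: powers_xinv_def)
  have "xpow (int i) * s = 1" by (simp add: i xpow_0 flip: xpow_add)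
  then show "\<exists>v. v * s = 1" ..
  assume "t \<in> powers_xinv"
  then obtain j where "t = xpow (- int j)" by (auto simp: powers_xinv_def)
  with i have "s * t = xpow (- int (i + j))" by (simp flip: xpow_add)
  then show "s * t \<in> powers_xinv" unfolding powers_xinv_def by (rule image_eqI) simp
next
  show "1 \<in> (powers_xinv :: 'k laurent set)"
    by (auto simp: powers_xinv_def simp flip: xpow_0 intro!: image_eqI[of _ _ 0])
next
  fix f g :: "'k laurent"
  assume "f \<in> carrier poly_ring_xinv" "g \<in> carrier poly_ring_xinv"
  then show "f + g \<in> carrier poly_ring_xinv" "f * g \<in> carrier poly_ring_xinv"
    using keys_mult[of f g] Poly_Mapping.keys_add[of f g]
    by (force simp: poly_ring_xinv_def)+
qed (auto simp: poly_ring_xinv_def powers_xinv_def xpow_def)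

section \<open>Localisation without fractions\<close>

text \<open>
  Elementwise form of the statement that \<open>S\<inverse>M \<rightarrow> P\<close> is bijective, for a module \<open>P\<close> on which \<open>S\<close> acts
  invertibly: \<open>m/1\<close> vanishes exactly if some \<open>s \<in> S\<close> kills \<open>m\<close>, and \<open>p\<close> is the image of \<open>m/s\<close> exactly if
  \<open>s p = h m\<close>.
\<close>

definition local_iso ::
  "'k::field laurent set \<Rightarrow> ('k laurent, 'm) module \<Rightarrow> ('m \<Rightarrow> 'p) \<Rightarrow> ('k laurent, 'p) module \<Rightarrow> bool" where
  "local_iso S M h P \<longleftrightarrow>
     (\<forall>m\<in>carrier M. h m = \<zero>\<^bsub>P\<^esub> \<longrightarrow> (\<exists>s\<in>S. s \<odot>\<^bsub>M\<^esub> m = \<zero>\<^bsub>M\<^esub>)) \<and>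
     (\<forall>p\<in>carrier P. \<exists>s\<in>S. \<exists>m\<in>carrier M. s \<odot>\<^bsub>P\<^esub> p = h m)"

locale localising = denominators R S + M: module R M
  for R S and M :: "('k::field laurent, 'm) module"
begin

lemma denom_carrier [simp]: "s \<in> S \<Longrightarrow> s \<in> carrier R"
  using denom_mem by blast

lemma smult_smult: "a \<in> carrier R \<Longrightarrow> b \<in> carrier R \<Longrightarrow> m \<in> carrier M
    \<Longrightarrow> a \<odot>\<^bsub>M\<^esub> (b \<odot>\<^bsub>M\<^esub> m) = (a * b) \<odot>\<^bsub>M\<^esub> m"
  using M.smult_assoc1 by simp

lemma one_smult [simp]: "m \<in> carrier M \<Longrightarrow> 1 \<odot>\<^bsub>M\<^esub> m = m"
  using M.smult_one by simp

text \<open>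
  Equalities of fractions are derived by scaling known relations; what remains is commutativity
  of the multiplication of coefficients.
\<close>

lemma smult_scale:
  assumes "a \<odot>\<^bsub>M\<^esub> m = b \<odot>\<^bsub>M\<^esub> l" "a \<in> carrier R" "b \<in> carrier R" "c \<in> carrier R"
    and "m \<in> carrier M" "l \<in> carrier M"
  shows "(c * a) \<odot>\<^bsub>M\<^esub> m = (c * b) \<odot>\<^bsub>M\<^esub> l"
  using assms by (simp flip: smult_smult)

lemma fraction_iff:
  assumes "m \<in> carrier M" "s \<in> S"
  shows "(m', s') \<in> fraction S M m s \<longleftrightarrow> m' \<in> carrier M \<and> s' \<in> S \<and>
    (\<exists>u\<in>S. (u * s') \<odot>\<^bsub>M\<^esub> m = (u * s) \<odot>\<^bsub>M\<^esub> m')"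
  using assms by (auto simp: fraction_def smult_smult)

lemma fraction_refl:
  assumes "m \<in> carrier M" "s \<in> S"
  shows "(m, s) \<in> fraction S M m s"
  using assms denom_one by (auto simp: fraction_iff)

text \<open>
  The relation defining fractions is symmetric and transitive.  For transitivity the witnesses \<open>u\<close>, \<open>v\<close> of two
  relations and the intermediate denominator combine to a witness for the composite.
\<close>

lemma fraction_eqI:
  assumes "m \<in> carrier M" "s \<in> S" "(m', s') \<in> fraction S M m s"
  shows "fraction S M m' s' = fraction S M m s"
proof -
  from assms obtain u where m': "m' \<in> carrier M" "s' \<in> S" and u: "u \<in> S"
    and eq: "(u * s') \<odot>\<^bsub>M\<^esub> m = (u * s) \<odot>\<^bsub>M\<^esub> m'"
    by (auto simp: fraction_iff)
  have "(\<exists>v\<in>S. (v * t) \<odot>\<^bsub>M\<^esub> m = (v * s) \<odot>\<^bsub>M\<^esub> l) \<longleftrightarrow> (\<exists>v\<in>S. (v * t) \<odot>\<^bsub>M\<^esub> m' = (v * s') \<odot>\<^bsub>M\<^esub> l)"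
    if l: "l \<in> carrier M" "t \<in> S" for l t
  proof
    assume "\<exists>v\<in>S. (v * t) \<odot>\<^bsub>M\<^esub> m = (v * s) \<odot>\<^bsub>M\<^esub> l"
    then obtain v where v: "v \<in> S" "(v * t) \<odot>\<^bsub>M\<^esub> m = (v * s) \<odot>\<^bsub>M\<^esub> l" by blast
    have "(u * s * v * t) \<odot>\<^bsub>M\<^esub> m' = (u * s * v * s') \<odot>\<^bsub>M\<^esub> l"
      using smult_scale[OF eq, of "v * t"] smult_scale[OF v(2), of "u * s'"] u v(1) m' l assms
      by (simp add: denom_mult ac_simps)
    then show "\<exists>v\<in>S. (v * t) \<odot>\<^bsub>M\<^esub> m' = (v * s') \<odot>\<^bsub>M\<^esub> l"
      using u v(1) assms(2) denom_mult by blast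
  next
    assume "\<exists>v\<in>S. (v * t) \<odot>\<^bsub>M\<^esub> m' = (v * s') \<odot>\<^bsub>M\<^esub> l"
    then obtain v where v: "v \<in> S" "(v * t) \<odot>\<^bsub>M\<^esub> m' = (v * s') \<odot>\<^bsub>M\<^esub> l" by blast
    have "(u * s' * v * t) \<odot>\<^bsub>M\<^esub> m = (u * s' * v * s) \<odot>\<^bsub>M\<^esub> l"
      using smult_scale[OF eq, of "v * t"] smult_scale[OF v(2), of "u * s"] u v(1) m' l assms
      by (simp add: denom_mult ac_simps)
    then show "\<exists>v\<in>S. (v * t) \<odot>\<^bsub>M\<^esub> m = (v * s) \<odot>\<^bsub>M\<^esub> l"
      using u v(1) m'(2) denom_mult by blast
  qed
  then show ?thesis
    using assms(1,2) m' by (auto simp: fraction_iff set_eq_iff)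
qed

text \<open>
  The operations on the localisation are unions over all representatives; they collapse to one
  class because the class does not depend on the representative.
\<close>

lemma UN_fraction:
  assumes "m \<in> carrier M" "s \<in> S"
    and "\<And>l t. (l, t) \<in> fraction S M m s \<Longrightarrow> g l t = c"
  shows "(\<Union>(l, t)\<in>fraction S M m s. g l t) = c"
  using assms(3) fraction_refl[OF assms(1,2)] by fastforce

lemma localisation_add:
  assumes "m \<in> carrier M" "s \<in> S" "m' \<in> carrier M" "s' \<in> S"
  shows "fraction S M m s \<oplus>\<^bsub>localisation R S M\<^esub> fraction S M m' s' =
    fraction S M (s' \<odot>\<^bsub>M\<^esub> m \<oplus>\<^bsub>M\<^esub> s \<odot>\<^bsub>M\<^esub> m') (s * s')"
proof -
  have "fraction S M (t' \<odot>\<^bsub>M\<^esub> l \<oplus>\<^bsub>M\<^esub> t \<odot>\<^bsub>M\<^esub> l') (t * t')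
      = fraction S M (s' \<odot>\<^bsub>M\<^esub> m \<oplus>\<^bsub>M\<^esub> s \<odot>\<^bsub>M\<^esub> m') (s * s')"
    if "(l, t) \<in> fraction S M m s" "(l', t') \<in> fraction S M m' s'" for l t l' t'
  proof -
    from that(1) assms obtain u where l: "l \<in> carrier M" "t \<in> S" "u \<in> S"
      and eq: "(u * t) \<odot>\<^bsub>M\<^esub> m = (u * s) \<odot>\<^bsub>M\<^esub> l" by (auto simp: fraction_iff)
    from that(2) assms obtain u' where l': "l' \<in> carrier M" "t' \<in> S" "u' \<in> S"
      and eq': "(u' * t') \<odot>\<^bsub>M\<^esub> m' = (u' * s') \<odot>\<^bsub>M\<^esub> l'" by (auto simp: fraction_iff)
    have 1: "(u * u' * (t * t') * s') \<odot>\<^bsub>M\<^esub> m = (u * u' * (s * s') * t') \<odot>\<^bsub>M\<^esub> l"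
      using smult_scale[OF eq, of "u' * t' * s'"] l l' assms by (simp add: denom_mult ac_simps)
    have 2: "(u * u' * (t * t') * s) \<odot>\<^bsub>M\<^esub> m' = (u * u' * (s * s') * t) \<odot>\<^bsub>M\<^esub> l'"
      using smult_scale[OF eq', of "u * t * s"] l l' assms by (simp add: denom_mult ac_simps)
    have "(u * u' * (t * t')) \<odot>\<^bsub>M\<^esub> (s' \<odot>\<^bsub>M\<^esub> m \<oplus>\<^bsub>M\<^esub> s \<odot>\<^bsub>M\<^esub> m')
        = (u * u' * (s * s')) \<odot>\<^bsub>M\<^esub> (t' \<odot>\<^bsub>M\<^esub> l \<oplus>\<^bsub>M\<^esub> t \<odot>\<^bsub>M\<^esub> l')"
      using l l' assms by (simp add: M.smult_r_distr denom_mult smult_smult 1 2)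
    then show ?thesis
      using l l' assms by (intro fraction_eqI) (auto simp: fraction_iff denom_mult)
  qed
  then show ?thesis
    unfolding localisation_def mk_module_simps
    by (intro UN_fraction assms)
qed

lemma localisation_smult:
  assumes "m \<in> carrier M" "s \<in> S" "t \<in> S" "t * f \<in> carrier R"
  shows "f \<odot>\<^bsub>localisation R S M\<^esub> fraction S M m s = fraction S M ((t * f) \<odot>\<^bsub>M\<^esub> m) (t * s)"
proof -
  have "fraction S M ((v * f) \<odot>\<^bsub>M\<^esub> l) (v * w) = fraction S M ((t * f) \<odot>\<^bsub>M\<^esub> m) (t * s)"
    if "(l, w) \<in> fraction S M m s" "v \<in> S" "v * f \<in> carrier R" for l w v
  proof -
    from that(1) assms obtain u where l: "l \<in> carrier M" "w \<in> S" "u \<in> S"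
      and eq: "(u * w) \<odot>\<^bsub>M\<^esub> m = (u * s) \<odot>\<^bsub>M\<^esub> l" by (auto simp: fraction_iff)
    have "(u * (v * w)) \<odot>\<^bsub>M\<^esub> ((t * f) \<odot>\<^bsub>M\<^esub> m) = (u * (t * s)) \<odot>\<^bsub>M\<^esub> ((v * f) \<odot>\<^bsub>M\<^esub> l)"
      using smult_scale[OF eq, of "v * (t * f)"] mult_mem[of v "t * f"] l that(2,3) assms
      by (simp add: smult_smult denom_mult mult_mem ac_simps)
    then show ?thesis
      using l that assms by (intro fraction_eqI) (auto simp: fraction_iff denom_mult)
  qed
  then have "(\<Union>v\<in>{v \<in> S. v * f \<in> carrier R}. fraction S M ((v * f) \<odot>\<^bsub>M\<^esub> l) (v * w))
      = fraction S M ((t * f) \<odot>\<^bsub>M\<^esub> m) (t * s)" if "(l, w) \<in> fraction S M m s" for l w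
    using that assms by auto
  then show ?thesis
    unfolding localisation_def mk_module_simps
    by (intro UN_fraction assms)
qed

end

context denominators
begin

lemma denom_cancel:
  assumes "module laurent_ring P" "s \<in> S" "p \<in> carrier P" "q \<in> carrier P"
    and "s \<odot>\<^bsub>P\<^esub> p = s \<odot>\<^bsub>P\<^esub> q"
  shows "p = q"
proof -
  interpret P: module laurent_ring P by fact
  obtain v where v: "v * s = 1" using denom_unit assms(2) by blast
  have "v \<odot>\<^bsub>P\<^esub> (s \<odot>\<^bsub>P\<^esub> p) = v \<odot>\<^bsub>P\<^esub> (s \<odot>\<^bsub>P\<^esub> q)" using assms by simp
  then show ?thesis
    using assms v P.smult_assoc1[of v s p] P.smult_assoc1[of v s q] P.smult_one by simp
qed

lemma denom_divide:
  assumes "module laurent_ring P" "s \<in> S" "p \<in> carrier P"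
  obtains q where "q \<in> carrier P" "s \<odot>\<^bsub>P\<^esub> q = p"
proof -
  interpret P: module laurent_ring P by fact
  obtain v where v: "v * s = 1" using denom_unit assms(2) by blast
  have "s \<odot>\<^bsub>P\<^esub> (v \<odot>\<^bsub>P\<^esub> p) = p"
    using assms v P.smult_assoc1[of s v] P.smult_one by (simp add: mult.commute)
  then show ?thesis
    using assms by (intro that[of "v \<odot>\<^bsub>P\<^esub> p"]) auto
qed

text \<open>
  The induced map sends \<open>m/s\<close> to the \<open>p\<close> with \<open>s p = h m\<close>, because \<open>h m / s = p / 1\<close> in \<open>S\<inverse>P\<close> and \<open>p \<mapsto> p/1\<close>
  is injective.
\<close>

lemma induced_map_fraction:
  assumes M: "module R M" and P: "module laurent_ring P" and h: "h \<in> mod_hom R M P"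
    and m: "m \<in> carrier M" "s \<in> S" and p: "p \<in> carrier P" "s \<odot>\<^bsub>P\<^esub> p = h m"
  shows "induced_map S P h (fraction S M m s) = p"
proof -
  interpret M: localising R S M by (intro localising.intro denominators_axioms M)
  interpret P: localising R S P by (intro localising.intro denominators_axioms restrict_module P)
  have hm: "h l \<in> carrier P" if "l \<in> carrier M" for l using mod_hom_closed[OF h] that .
  have "fraction S P (h l) t = fraction S P p 1" if "(l, t) \<in> fraction S M m s" for l t
  proof -
    from that m obtain u where l: "l \<in> carrier M" "t \<in> S" "u \<in> S"
      and eq: "(u * t) \<odot>\<^bsub>M\<^esub> m = (u * s) \<odot>\<^bsub>M\<^esub> l" by (auto simp: M.fraction_iff)
    have "(u * t) \<odot>\<^bsub>P\<^esub> (h m) = (u * s) \<odot>\<^bsub>P\<^esub> h l"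
      using eq l m mod_hom_smult[OF h, of "u * t" m] mod_hom_smult[OF h, of "u * s" l] denom_mult
      by simp
    then have "(u * s * t) \<odot>\<^bsub>P\<^esub> p = (u * s * 1) \<odot>\<^bsub>P\<^esub> h l"
      using l m p(1) hm by (simp add: P.smult_smult denom_mult ac_simps flip: p(2))
    moreover have "u * s \<in> S" using l m denom_mult by blast
    ultimately show ?thesis
      using l m p hm denom_one by (intro P.fraction_eqI) (auto simp: P.fraction_iff)
  qed
  then have "localised_map S P h (fraction S M m s) = fraction S P p 1"
    unfolding localised_map_def by (intro M.UN_fraction m)
  moreover have "inj_on (\<lambda>p. fraction S P p 1) (carrier P)"
  proof (rule inj_onI)
    fix p q assume pq: "p \<in> carrier P" "q \<in> carrier P" "fraction S P p 1 = fraction S P q 1"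
    then have "(p, 1) \<in> fraction S P q 1"
      using P.fraction_refl[of p 1] denom_one by simp
    then obtain u where "u \<in> S" "u \<odot>\<^bsub>P\<^esub> q = u \<odot>\<^bsub>P\<^esub> p"
      using pq denom_one by (auto simp: P.fraction_iff)
    then show "p = q" using denom_cancel[OF P] pq by metis
  qed
  ultimately show ?thesis
    using p(1) by (simp add: induced_map_def the_inv_into_f_f[where f = "\<lambda>p. fraction S P p 1"])
qed

text \<open>
  By the previous lemma the induced map is determined by \<open>s p = h m\<close>, from which its linearity follows
  after multiplication by a common denominator.  So being an isomorphism is a question of
  bijectivity only.
\<close>

lemma induced_map_iso_iff:
  assumes M: "module R M" and P: "module laurent_ring P" and h: "h \<in> mod_hom R M P"
  shows "induced_map S P h \<in> mod_iso laurent_ring (localisation R S M) P \<longleftrightarrow> local_iso S M h P"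
    (is "?I \<in> mod_iso _ ?L P \<longleftrightarrow> _")
proof -
  interpret M: localising R S M by (intro localising.intro denominators_axioms M)
  interpret P: localising R S P by (intro localising.intro denominators_axioms restrict_module P)
  interpret P': module laurent_ring P by (rule P)
  have hm: "h l \<in> carrier P" if "l \<in> carrier M" for l using mod_hom_closed[OF h] that .
  have I: "?I (fraction S M m s) \<in> carrier P \<and> s \<odot>\<^bsub>P\<^esub> ?I (fraction S M m s) = h m"
    if m: "m \<in> carrier M" "s \<in> S" for m s
  proof -
    obtain p where "p \<in> carrier P" "s \<odot>\<^bsub>P\<^esub> p = h m"
      using denom_divide[OF P m(2) hm[OF m(1)]] .
    then show ?thesis using induced_map_fraction[OF M P h m] by simp
  qed
  have L: "carrier ?L = {fraction S M m s | m s. m \<in> carrier M \<and> s \<in> S}"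
    by (simp add: localisation_def)
  have hom: "?I \<in> mod_hom laurent_ring ?L P"
  proof (rule mod_homI)
    fix A assume "A \<in> carrier ?L"
    then show "?I A \<in> carrier P" using I by (auto simp: L)
  next
    fix A B assume "A \<in> carrier ?L" "B \<in> carrier ?L"
    then obtain m s l t where ms: "m \<in> carrier M" "s \<in> S" "l \<in> carrier M" "t \<in> S"
      and A: "A = fraction S M m s" "B = fraction S M l t" by (auto simp: L)
    have "(s * t) \<odot>\<^bsub>P\<^esub> (?I A \<oplus>\<^bsub>P\<^esub> ?I B) = t \<odot>\<^bsub>P\<^esub> (s \<odot>\<^bsub>P\<^esub> ?I A) \<oplus>\<^bsub>P\<^esub> s \<odot>\<^bsub>P\<^esub> (t \<odot>\<^bsub>P\<^esub> ?I B)"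
      using ms I[of m s] I[of l t] P.smult_smult[of t s "?I A"] P.smult_smult[of s t "?I B"]
      unfolding A by (simp add: P.M.smult_r_distr denom_mult mult.commute[of t s])
    also have "\<dots> = h (t \<odot>\<^bsub>M\<^esub> m \<oplus>\<^bsub>M\<^esub> s \<odot>\<^bsub>M\<^esub> l)"
      using ms A I by (simp add: mod_hom_add[OF h] mod_hom_smult[OF h])
    finally show "?I (A \<oplus>\<^bsub>?L\<^esub> B) = ?I A \<oplus>\<^bsub>P\<^esub> ?I B"
      unfolding A M.localisation_add[OF ms]
      using ms I denom_mult by (intro induced_map_fraction[OF M P h]) auto
  next
    fix f A assume "A \<in> carrier ?L"
    then obtain m s where ms: "m \<in> carrier M" "s \<in> S" and A: "A = fraction S M m s"
      by (auto simp: L)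
    obtain t where t: "t \<in> S" "t * f \<in> carrier R" using clear_denom by blast
    have "(t * s) \<odot>\<^bsub>P\<^esub> (f \<odot>\<^bsub>P\<^esub> ?I A) = (t * f) \<odot>\<^bsub>P\<^esub> (s \<odot>\<^bsub>P\<^esub> ?I A)"
      using ms A I P'.smult_assoc1[of "t * s" f "?I A"] P'.smult_assoc1[of "t * f" s "?I A"]
      by (simp add: ac_simps)
    also have "\<dots> = h ((t * f) \<odot>\<^bsub>M\<^esub> m)"
      using ms A I t by (simp add: mod_hom_smult[OF h])
    finally show "?I (f \<odot>\<^bsub>?L\<^esub> A) = f \<odot>\<^bsub>P\<^esub> ?I A"
      unfolding A M.localisation_smult[OF ms t]
      using ms I t denom_mult by (intro induced_map_fraction[OF M P h]) auto
  qed
  have surj: "?I ` carrier ?L = carrier P \<longleftrightarrow> (\<forall>p\<in>carrier P. \<exists>s\<in>S. \<exists>m\<in>carrier M. s \<odot>\<^bsub>P\<^esub> p = h m)"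
  proof
    assume eq: "?I ` carrier ?L = carrier P"
    show "\<forall>p\<in>carrier P. \<exists>s\<in>S. \<exists>m\<in>carrier M. s \<odot>\<^bsub>P\<^esub> p = h m"
    proof
      fix p assume "p \<in> carrier P"
      then have "p \<in> ?I ` carrier ?L" by (simp only: eq)
      then obtain m s where "m \<in> carrier M" "s \<in> S" "p = ?I (fraction S M m s)"
        by (auto simp: L)
      then show "\<exists>s\<in>S. \<exists>m\<in>carrier M. s \<odot>\<^bsub>P\<^esub> p = h m" using I by blast
    qed
  next
    assume r: "\<forall>p\<in>carrier P. \<exists>s\<in>S. \<exists>m\<in>carrier M. s \<odot>\<^bsub>P\<^esub> p = h m"
    show "?I ` carrier ?L = carrier P"
    proof
      show "?I ` carrier ?L \<subseteq> carrier P" using I by (auto simp: L)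
      show "carrier P \<subseteq> ?I ` carrier ?L"
      proof
        fix p assume p: "p \<in> carrier P"
        with r obtain m s where ms: "m \<in> carrier M" "s \<in> S" "s \<odot>\<^bsub>P\<^esub> p = h m" by blast
        then have "p = ?I (fraction S M m s)"
          using induced_map_fraction[OF M P h _ _ p] by simp
        then show "p \<in> ?I ` carrier ?L" using ms by (auto simp: L)
      qed
    qed
  qed
  have inj: "inj_on ?I (carrier ?L) \<longleftrightarrow>
      (\<forall>m\<in>carrier M. h m = \<zero>\<^bsub>P\<^esub> \<longrightarrow> (\<exists>s\<in>S. s \<odot>\<^bsub>M\<^esub> m = \<zero>\<^bsub>M\<^esub>))"
  proof
    assume inj: "inj_on ?I (carrier ?L)"
    show "\<forall>m\<in>carrier M. h m = \<zero>\<^bsub>P\<^esub> \<longrightarrow> (\<exists>s\<in>S. s \<odot>\<^bsub>M\<^esub> m = \<zero>\<^bsub>M\<^esub>)"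
    proof (intro ballI impI)
      fix m assume m: "m \<in> carrier M" "h m = \<zero>\<^bsub>P\<^esub>"
      have h0: "h \<zero>\<^bsub>M\<^esub> = \<zero>\<^bsub>P\<^esub>"
        using mod_hom_zero[OF h] M.M.abelian_group_axioms P.M.abelian_group_axioms by blast
      have "?I (fraction S M m 1) = ?I (fraction S M \<zero>\<^bsub>M\<^esub> 1)"
        using m h0 denom_one by (simp add: induced_map_fraction[OF M P h, where p = "\<zero>\<^bsub>P\<^esub>"])
      then have "fraction S M m 1 = fraction S M \<zero>\<^bsub>M\<^esub> 1"
        by (rule inj_onD[OF inj]) (use m denom_one in \<open>auto simp: L\<close>)
      then have "(\<zero>\<^bsub>M\<^esub>, 1) \<in> fraction S M m 1"
        using M.fraction_refl[of "\<zero>\<^bsub>M\<^esub>" 1] denom_one by simp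
      then show "\<exists>s\<in>S. s \<odot>\<^bsub>M\<^esub> m = \<zero>\<^bsub>M\<^esub>"
        using m denom_one by (auto simp: M.fraction_iff)
    qed
  next
    assume r: "\<forall>m\<in>carrier M. h m = \<zero>\<^bsub>P\<^esub> \<longrightarrow> (\<exists>s\<in>S. s \<odot>\<^bsub>M\<^esub> m = \<zero>\<^bsub>M\<^esub>)"
    show "inj_on ?I (carrier ?L)"
    proof (rule inj_onI)
      fix A B assume "A \<in> carrier ?L" "B \<in> carrier ?L" and eq: "?I A = ?I B"
      then obtain m s l t where ms: "m \<in> carrier M" "s \<in> S" "l \<in> carrier M" "t \<in> S"
        and A: "A = fraction S M m s" "B = fraction S M l t" by (auto simp: L)
      let ?p = "?I A"
      have p: "?p \<in> carrier P" "s \<odot>\<^bsub>P\<^esub> ?p = h m" "t \<odot>\<^bsub>P\<^esub> ?p = h l"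
        using I[OF ms(1,2)] I[OF ms(3,4)] A eq by auto
      have "h (t \<odot>\<^bsub>M\<^esub> m \<ominus>\<^bsub>M\<^esub> s \<odot>\<^bsub>M\<^esub> l) = t \<odot>\<^bsub>P\<^esub> h m \<ominus>\<^bsub>P\<^esub> s \<odot>\<^bsub>P\<^esub> h l"
        using ms mod_hom_a_minus[OF h M.M.abelian_group_axioms P.M.abelian_group_axioms]
        by (simp add: mod_hom_smult[OF h])
      also have "\<dots> = (t * s) \<odot>\<^bsub>P\<^esub> ?p \<ominus>\<^bsub>P\<^esub> (t * s) \<odot>\<^bsub>P\<^esub> ?p"
        using ms p(1) by (simp add: P.smult_smult ac_simps flip: p(2,3))
      also have "\<dots> = \<zero>\<^bsub>P\<^esub>" using ms p(1) by (simp add: P.M.r_neg a_minus_def denom_mult)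
      finally obtain u where u: "u \<in> S" "u \<odot>\<^bsub>M\<^esub> (t \<odot>\<^bsub>M\<^esub> m \<ominus>\<^bsub>M\<^esub> s \<odot>\<^bsub>M\<^esub> l) = \<zero>\<^bsub>M\<^esub>"
        using r ms by (metis M.M.minus_closed M.denom_carrier M.M.smult_closed)
      have "(u * t) \<odot>\<^bsub>M\<^esub> m \<ominus>\<^bsub>M\<^esub> (u * s) \<odot>\<^bsub>M\<^esub> l = \<zero>\<^bsub>M\<^esub>"
        using u ms by (simp add: a_minus_def M.M.smult_r_distr M.M.smult_r_minus M.smult_smult)
      then have "(u * t) \<odot>\<^bsub>M\<^esub> m = (u * s) \<odot>\<^bsub>M\<^esub> l"
        using u ms denom_mult M.M.M.minus_eq_zero_iff[of "(u * t) \<odot>\<^bsub>M\<^esub> m" "(u * s) \<odot>\<^bsub>M\<^esub> l"]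
        by simp
      then have "fraction S M l t = fraction S M m s"
        using u ms by (intro M.fraction_eqI) (auto simp: M.fraction_iff)
      then show "A = B" using A by simp
    qed
  qed
  show ?thesis
    using hom surj inj by (auto simp: mod_iso_def bij_betw_def local_iso_def)
qed

end

text \<open>
  This is the only form in which quasi-coherence is used from here on.
\<close>

lemma qcoh_iff:
  "qcoh F \<longleftrightarrow>
     module poly_ring_x (lmod F) \<and> module laurent_ring (cmod F) \<and> module poly_ring_xinv (rmod F) \<and>
     sig F \<in> mod_hom poly_ring_x (lmod F) (cmod F) \<and>
     tau F \<in> mod_hom poly_ring_xinv (rmod F) (cmod F) \<and>
     local_iso powers_x (lmod F) (sig F) (cmod F) \<and>
     local_iso powers_xinv (rmod F) (tau F) (cmod F)"
  using poly_x.induced_map_iso_iff poly_xinv.induced_map_iso_iff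
  unfolding qcoh_def by blast

section \<open>Extensions of modules\<close>

lemma mod_hom_comp:
  assumes "g \<in> mod_hom R L M" "h \<in> mod_hom R M N"
  shows "(\<lambda>m. h (g m)) \<in> mod_hom R L N"
  using assms by (intro mod_homI) (auto simp: mod_hom_closed mod_hom_add mod_hom_smult)

locale mod_extension = L: module R L + E: module R E + Q: module R Q
  for R :: "'r ring" and L :: "('r, 'l) module" and E :: "('r, 'e) module"
    and Q :: "('r, 'q) module" +
  fixes i :: "'l \<Rightarrow> 'e" and p :: "'e \<Rightarrow> 'q"
  assumes i_hom: "i \<in> mod_hom R L E"
    and p_hom: "p \<in> mod_hom R E Q"
    and exact: "short_exact L i E p Q"
begin

lemmas i_closed [simp, intro] = mod_hom_closed[OF i_hom]
lemmas i_add = mod_hom_add[OF i_hom]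
lemmas i_smult = mod_hom_smult[OF i_hom]
lemmas i_zero [simp] = mod_hom_zero[OF i_hom L.M.abelian_group_axioms E.M.abelian_group_axioms]
lemmas i_a_inv = mod_hom_a_inv[OF i_hom L.M.abelian_group_axioms E.M.abelian_group_axioms]
lemmas p_closed [simp, intro] = mod_hom_closed[OF p_hom]
lemmas p_add = mod_hom_add[OF p_hom]
lemmas p_smult = mod_hom_smult[OF p_hom]
lemmas p_zero [simp] = mod_hom_zero[OF p_hom E.M.abelian_group_axioms Q.M.abelian_group_axioms]
lemmas p_a_inv = mod_hom_a_inv[OF p_hom E.M.abelian_group_axioms Q.M.abelian_group_axioms]
lemmas p_minus = mod_hom_a_minus[OF p_hom E.M.abelian_group_axioms Q.M.abelian_group_axioms]

lemma i_inj: "l \<in> carrier L \<Longrightarrow> l' \<in> carrier L \<Longrightarrow> i l = i l' \<longleftrightarrow> l = l'"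
  using exact by (auto simp: short_exact_def inj_on_def)

lemma p_i [simp]: "l \<in> carrier L \<Longrightarrow> p (i l) = \<zero>\<^bsub>Q\<^esub>"
  using exact by (auto simp: short_exact_def)

lemma kernel_E:
  assumes "e \<in> carrier E" "p e = \<zero>\<^bsub>Q\<^esub>"
  obtains l where "l \<in> carrier L" "e = i l"
proof -
  have "e \<in> i ` carrier L" using exact assms by (simp add: short_exact_def)
  then show ?thesis using that by blast
qed

lemma lift_E:
  assumes "q \<in> carrier Q"
  obtains e where "e \<in> carrier E" "p e = q"
proof -
  have "q \<in> p ` carrier E" using exact assms by (simp add: short_exact_def)
  then show ?thesis using that by blast
qed

lemma same_image_E:
  assumes "e \<in> carrier E" "e' \<in> carrier E" "p e = p e'"
  obtains l where "l \<in> carrier L" "e = i l \<oplus>\<^bsub>E\<^esub> e'"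
proof -
  have "p (e \<ominus>\<^bsub>E\<^esub> e') = \<zero>\<^bsub>Q\<^esub>"
    using assms by (simp add: p_minus Q.M.minus_eq_zero_iff)
  then obtain l where l: "l \<in> carrier L" "e \<ominus>\<^bsub>E\<^esub> e' = i l"
    using assms by (meson E.M.minus_closed kernel_E)
  then have "e = i l \<oplus>\<^bsub>E\<^esub> e'"
    using assms by (simp add: a_minus_def E.M.a_assoc E.M.l_neg flip: l(2))
  with l that show ?thesis by blast
qed

end

lemma short_five_lemma:
  assumes "mod_extension R L E Q i p" "mod_extension R L E' Q i' p'"
    and h: "h \<in> mod_hom R E E'"
    and hi: "\<And>l. l \<in> carrier L \<Longrightarrow> h (i l) = i' l"
    and ph: "\<And>e. e \<in> carrier E \<Longrightarrow> p' (h e) = p e"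
  shows "bij_betw h (carrier E) (carrier E')"
proof -
  interpret X: mod_extension R L E Q i p by fact
  interpret Y: mod_extension R L E' Q i' p' by fact
  note h_closed [simp] = mod_hom_closed[OF h]
  have "inj_on h (carrier E)"
  proof (rule inj_onI)
    fix e f assume e: "e \<in> carrier E" "f \<in> carrier E" and eq: "h e = h f"
    then have "p e = p f" using ph by metis
    then obtain l where l: "l \<in> carrier L" "e = i l \<oplus>\<^bsub>E\<^esub> f" using e X.same_image_E by metis
    then have "i' l \<oplus>\<^bsub>E'\<^esub> h f = h f" using e eq by (simp add: mod_hom_add[OF h] hi)
    then have "i' l = i' \<zero>\<^bsub>L\<^esub>" using l(1) e by simp
    then have "l = \<zero>\<^bsub>L\<^esub>" using l(1) by (simp add: Y.i_inj del: Y.i_zero)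
    then show "e = f" using l e by simp
  qed
  moreover have "h ` carrier E = carrier E'"
  proof
    show "h ` carrier E \<subseteq> carrier E'" by auto
    show "carrier E' \<subseteq> h ` carrier E"
    proof
      fix e' assume e': "e' \<in> carrier E'"
      obtain e where e: "e \<in> carrier E" "p e = p' e'" using X.lift_E[OF Y.p_closed[OF e']] .
      then have "p' e' = p' (h e)" using ph by simp
      then obtain l where l: "l \<in> carrier L" "e' = i' l \<oplus>\<^bsub>E'\<^esub> h e"
        using e e' h_closed Y.same_image_E by metis
      then have "e' = h (i l \<oplus>\<^bsub>E\<^esub> e)" using e by (simp add: mod_hom_add[OF h] hi)
      then show "e' \<in> h ` carrier E" using l e by blast
    qed
  qed
  ultimately show ?thesis by (simp add: bij_betw_def)
qed

text \<open>
  A diagram chase.  If \<open>b e = 0\<close>, some \<open>s\<close> kills the image of \<open>e\<close> in \<open>Q\<close>, so \<open>s e\<close> comes from \<open>L\<close>, where some \<open>t\<close>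
  kills it.  For \<open>e'\<close> in \<open>E'\<close>, some multiple \<open>s e'\<close> agrees in \<open>Q'\<close> with an element of the image of \<open>b\<close>, and
  the difference comes from \<open>L'\<close>, where a further multiple lies in the image of \<open>a\<close>.
\<close>

lemma (in denominators) local_iso_extension:
  assumes "mod_extension R L E Q i p"
    and "mod_extension laurent_ring L' E' Q' i' p'"
    and a: "a \<in> mod_hom R L L'" and b: "b \<in> mod_hom R E E'" and c: "c \<in> mod_hom R Q Q'"
    and bi: "\<And>l. l \<in> carrier L \<Longrightarrow> b (i l) = i' (a l)"
    and pb: "\<And>e. e \<in> carrier E \<Longrightarrow> p' (b e) = c (p e)"
    and La: "local_iso S L a L'" and Lc: "local_iso S Q c Q'"
  shows "local_iso S E b E'"
proof -
  interpret X: mod_extension R L E Q i p by fact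
  interpret Y: mod_extension laurent_ring L' E' Q' i' p' by fact
  interpret E: localising R S E
    by (intro localising.intro denominators_axioms X.E.module_axioms)
  interpret E': localising R S E'
    by (intro localising.intro denominators_axioms restrict_module Y.E.module_axioms)
  note [simp] = mod_hom_closed[OF a] mod_hom_closed[OF b] mod_hom_closed[OF c]
  note ab = X.L.M.abelian_group_axioms Y.L.M.abelian_group_axioms
    X.E.M.abelian_group_axioms Y.E.M.abelian_group_axioms
  show ?thesis
    unfolding local_iso_def
  proof (intro conjI ballI impI)
    fix e assume e: "e \<in> carrier E" "b e = \<zero>\<^bsub>E'\<^esub>"
    then have "c (p e) = \<zero>\<^bsub>Q'\<^esub>" using pb[of e] by simp
    then obtain s where s: "s \<in> S" "s \<odot>\<^bsub>Q\<^esub> p e = \<zero>\<^bsub>Q\<^esub>"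
      using Lc e by (auto simp: local_iso_def)
    then obtain l where l: "l \<in> carrier L" "s \<odot>\<^bsub>E\<^esub> e = i l"
      using e X.kernel_E[of "s \<odot>\<^bsub>E\<^esub> e"] by (auto simp: X.p_smult)
    have "i' (a l) = b (s \<odot>\<^bsub>E\<^esub> e)"
      using l by (simp add: bi)
    also have "\<dots> = i' \<zero>\<^bsub>L'\<^esub>" using e s by (simp add: mod_hom_smult[OF b])
    finally have "a l = \<zero>\<^bsub>L'\<^esub>" using l(1) by (simp add: Y.i_inj del: Y.i_zero)
    then obtain t where t: "t \<in> S" "t \<odot>\<^bsub>L\<^esub> l = \<zero>\<^bsub>L\<^esub>"
      using La l by (auto simp: local_iso_def)
    have "(t * s) \<odot>\<^bsub>E\<^esub> e = t \<odot>\<^bsub>E\<^esub> i l"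
      using t(1) s(1) e l(1) by (simp add: E.smult_smult flip: l(2))
    also have "\<dots> = \<zero>\<^bsub>E\<^esub>" using t l(1) by (simp flip: X.i_smult)
    finally show "\<exists>s\<in>S. s \<odot>\<^bsub>E\<^esub> e = \<zero>\<^bsub>E\<^esub>" using t(1) s(1) denom_mult by blast
  next
    fix e' assume e': "e' \<in> carrier E'"
    then obtain s q where s: "s \<in> S" "q \<in> carrier Q" "s \<odot>\<^bsub>Q'\<^esub> p' e' = c q"
      using Lc by (auto simp: local_iso_def dest!: bspec[of "carrier Q'" _ "p' e'"])
    obtain e where e: "e \<in> carrier E" "p e = q" using X.lift_E s(2) by blast
    have "p' (s \<odot>\<^bsub>E'\<^esub> e') = p' (b e)" using e e' s by (simp add: Y.p_smult pb)
    then obtain l' where l': "l' \<in> carrier L'" "s \<odot>\<^bsub>E'\<^esub> e' = i' l' \<oplus>\<^bsub>E'\<^esub> b e"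
      using e e' s(1) Y.same_image_E[of "s \<odot>\<^bsub>E'\<^esub> e'" "b e"] by auto
    obtain t l where t: "t \<in> S" "l \<in> carrier L" "t \<odot>\<^bsub>L'\<^esub> l' = a l"
      using La l'(1) by (auto simp: local_iso_def)
    have "(t * s) \<odot>\<^bsub>E'\<^esub> e' = t \<odot>\<^bsub>E'\<^esub> (i' l' \<oplus>\<^bsub>E'\<^esub> b e)"
      using t(1) s(1) e' by (simp add: E'.smult_smult flip: l'(2))
    also have "\<dots> = i' (a l) \<oplus>\<^bsub>E'\<^esub> t \<odot>\<^bsub>E'\<^esub> b e"
      using t l'(1) e s(1) by (simp add: Y.E.smult_r_distr flip: Y.i_smult)
    also have "\<dots> = b (i l \<oplus>\<^bsub>E\<^esub> t \<odot>\<^bsub>E\<^esub> e)"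
      using t e by (simp add: mod_hom_add[OF b] mod_hom_smult[OF b] bi)
    finally show "\<exists>s\<in>S. \<exists>m\<in>carrier E. s \<odot>\<^bsub>E'\<^esub> e' = b m"
      using denom_mult[OF t(1) s(1)] t e
      by (intro bexI[of _ "t * s"] bexI[of _ "i l \<oplus>\<^bsub>E\<^esub> t \<odot>\<^bsub>E\<^esub> e"]) auto
  qed
qed

text \<open>
  A lift \<open>e0\<close> of \<open>1\<close> splits a sequence that ends in the ring itself: every element of \<open>E\<close> is uniquely of the form
  \<open>i l + f e0\<close>, where \<open>f\<close> is its image in \<open>R\<close>.
\<close>

locale free_extension = laurent_subring R + mod_extension R L E "ring_as_module R" i p
  for R :: "'k::field laurent ring" and L :: "('k laurent, 'l) module"
    and E :: "('k laurent, 'e) module" and i p +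
  fixes e0
  assumes e0: "e0 \<in> carrier E" "p e0 = 1"
begin

lemma decompose:
  assumes "e \<in> carrier E"
  obtains l where "l \<in> carrier L" "e = i l \<oplus>\<^bsub>E\<^esub> p e \<odot>\<^bsub>E\<^esub> e0"
proof -
  have pe: "p e \<in> carrier R" using p_closed[OF assms] by simp
  then have "p e = p (p e \<odot>\<^bsub>E\<^esub> e0)" using e0 by (simp add: p_smult)
  then show ?thesis
    using same_image_E[of e "p e \<odot>\<^bsub>E\<^esub> e0"] that assms e0 pe by auto
qed

lemma hom_eqI:
  assumes g: "g \<in> mod_hom R E X" and h: "h \<in> mod_hom R E X"
    and "\<And>l. l \<in> carrier L \<Longrightarrow> g (i l) = h (i l)" and "g e0 = h e0" and e: "e \<in> carrier E"
  shows "g e = h e"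
proof -
  obtain l f where "l \<in> carrier L" "f \<in> carrier R" "e = i l \<oplus>\<^bsub>E\<^esub> f \<odot>\<^bsub>E\<^esub> e0"
    using decompose[OF e] p_closed[OF e] by (metis ring_as_module_simps(1))
  then show ?thesis
    using e0 assms(3,4)
    by (simp add: mod_hom_add[OF g] mod_hom_add[OF h] mod_hom_smult[OF g] mod_hom_smult[OF h])
qed

text \<open>
  The projection of \<open>E\<close> onto \<open>L\<close> along the free summand \<open>R e0\<close>.
\<close>

definition coord :: "'e \<Rightarrow> 'l" where
  "coord e = (THE l. l \<in> carrier L \<and> e = i l \<oplus>\<^bsub>E\<^esub> p e \<odot>\<^bsub>E\<^esub> e0)"

lemma coord_eqI:
  assumes "l \<in> carrier L" "f \<in> carrier R"
  shows "coord (i l \<oplus>\<^bsub>E\<^esub> f \<odot>\<^bsub>E\<^esub> e0) = l"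
proof -
  have p: "p (i l \<oplus>\<^bsub>E\<^esub> f \<odot>\<^bsub>E\<^esub> e0) = f"
    using assms e0 by (simp add: p_add p_smult)
  show ?thesis
    unfolding coord_def p using assms e0 by (intro the_equality) (auto simp: i_inj)
qed

lemma coord:
  assumes "e \<in> carrier E"
  shows "coord e \<in> carrier L" "i (coord e) \<oplus>\<^bsub>E\<^esub> p e \<odot>\<^bsub>E\<^esub> e0 = e"
proof -
  have pe: "p e \<in> carrier R" using p_closed[OF assms] by simp
  obtain l where l: "l \<in> carrier L" and eq: "e = i l \<oplus>\<^bsub>E\<^esub> p e \<odot>\<^bsub>E\<^esub> e0" using decompose assms by blast
  then have "coord e = l" using coord_eqI[OF l pe] by simp
  with l eq show "coord e \<in> carrier L" "i (coord e) \<oplus>\<^bsub>E\<^esub> p e \<odot>\<^bsub>E\<^esub> e0 = e" by auto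
qed

lemma coord_hom: "coord \<in> mod_hom R E L"
proof (rule mod_homI)
  fix e e' assume e: "e \<in> carrier E" "e' \<in> carrier E"
  have pe: "p e \<in> carrier R" "p e' \<in> carrier R" using p_closed e by auto
  have "e \<oplus>\<^bsub>E\<^esub> e' = (i (coord e) \<oplus>\<^bsub>E\<^esub> p e \<odot>\<^bsub>E\<^esub> e0) \<oplus>\<^bsub>E\<^esub> (i (coord e') \<oplus>\<^bsub>E\<^esub> p e' \<odot>\<^bsub>E\<^esub> e0)"
    using e by (simp add: coord)
  also have "\<dots> = i (coord e \<oplus>\<^bsub>L\<^esub> coord e') \<oplus>\<^bsub>E\<^esub> (p e + p e') \<odot>\<^bsub>E\<^esub> e0"
    using e e0 pe E.smult_l_distr[of "p e" "p e'" e0] by (simp add: coord(1) i_add E.M.a_ac)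
  finally show "coord (e \<oplus>\<^bsub>E\<^esub> e') = coord e \<oplus>\<^bsub>L\<^esub> coord e'"
    using coord_eqI[of "coord e \<oplus>\<^bsub>L\<^esub> coord e'" "p e + p e'"] coord e pe add_mem by simp
next
  fix r e assume r: "r \<in> carrier R" and e: "e \<in> carrier E"
  have pe: "p e \<in> carrier R" using p_closed e by auto
  have "r \<odot>\<^bsub>E\<^esub> e = r \<odot>\<^bsub>E\<^esub> (i (coord e) \<oplus>\<^bsub>E\<^esub> p e \<odot>\<^bsub>E\<^esub> e0)"
    using e by (simp add: coord)
  also have "\<dots> = i (r \<odot>\<^bsub>L\<^esub> coord e) \<oplus>\<^bsub>E\<^esub> (r * p e) \<odot>\<^bsub>E\<^esub> e0"
    using e e0 pe r E.smult_assoc1[of r "p e" e0] by (simp add: coord(1) i_smult E.smult_r_distr)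
  finally show "coord (r \<odot>\<^bsub>E\<^esub> e) = r \<odot>\<^bsub>L\<^esub> coord e"
    using coord_eqI[of "r \<odot>\<^bsub>L\<^esub> coord e" "r * p e"] coord e r pe mult_mem by simp
qed (rule coord)

end

text \<open>
  The isomorphism is \<open>i l + f e0 \<mapsto> i' l + f e0'\<close>.
\<close>

lemma free_extension_iso:
  assumes "free_extension R L E i p e0" "free_extension R L E' i' p' e0'"
  shows "\<exists>h\<in>mod_hom R E E'. bij_betw h (carrier E) (carrier E') \<and>
    (\<forall>l\<in>carrier L. h (i l) = i' l) \<and> (\<forall>e\<in>carrier E. p' (h e) = p e) \<and> h e0 = e0'"
proof -
  interpret X: free_extension R L E i p e0 by fact
  interpret Y: free_extension R L E' i' p' e0' by fact
  have pe [simp]: "p e \<in> carrier R" if "e \<in> carrier E" for e using X.p_closed that by simp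
  let ?h = "\<lambda>e. i' (X.coord e) \<oplus>\<^bsub>E'\<^esub> p e \<odot>\<^bsub>E'\<^esub> e0'"
  note [simp] = X.coord(1) X.e0 Y.e0
  have h: "?h \<in> mod_hom R E E'"
  proof (rule mod_homI)
    fix e e' assume e: "e \<in> carrier E" "e' \<in> carrier E"
    then show "?h (e \<oplus>\<^bsub>E\<^esub> e') = ?h e \<oplus>\<^bsub>E'\<^esub> ?h e'"
      using Y.E.smult_l_distr[of "p e" "p e'" e0']
      by (simp add: mod_hom_add[OF X.coord_hom] Y.i_add X.p_add Y.E.M.a_ac)
  next
    fix r e assume e: "r \<in> carrier R" "e \<in> carrier E"
    then show "?h (r \<odot>\<^bsub>E\<^esub> e) = r \<odot>\<^bsub>E'\<^esub> ?h e"
      using Y.E.smult_assoc1[of r "p e" e0']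
      by (simp add: mod_hom_smult[OF X.coord_hom] Y.i_smult X.p_smult Y.E.smult_r_distr)
  qed auto
  have hi: "?h (i l) = i' l" if l: "l \<in> carrier L" for l
    using X.coord_eqI[OF l X.zero_mem] l X.E.smult_l_null[of e0] Y.E.smult_l_null[of e0'] by simp
  have ph: "p' (?h e) = p e" if "e \<in> carrier E" for e
    using that by (simp add: Y.p_add Y.p_smult)
  have "?h e0 = e0'"
    using X.coord_eqI[OF X.L.M.zero_closed X.one_mem] X.E.smult_one[of e0] Y.E.smult_one[of e0'] by simp
  then show ?thesis
    using h hi ph short_five_lemma[OF X.mod_extension_axioms Y.mod_extension_axioms h hi ph]
    by (intro bexI[OF _ h] conjI ballI)
qed

interpretation laurent: laurent_subring "laurent_ring :: 'k::field laurent ring"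
  by (rule laurent_subring_laurent)

section \<open>Extensions of a twisting sheaf\<close>

lemma twist_simps [simp]:
  "lmod (twist n) = ring_as_module poly_ring_x" "cmod (twist n) = ring_as_module laurent_ring"
  "rmod (twist n) = ring_as_module poly_ring_xinv" "sig (twist n) f = f" "tau (twist n) f = f * xpow n"
  by (simp_all add: twist_def)

text \<open>
  Both structure maps of a twisting sheaf have this form: the unit is \<open>1\<close> on the left and \<open>x\<^sup>n\<close> on the right.
\<close>

lemma (in denominators) local_iso_mult_unit:
  assumes "v * u = 1"
  shows "local_iso S (ring_as_module R) (\<lambda>g. g * u) (ring_as_module laurent_ring)"
  unfolding local_iso_def
proof (intro conjI ballI impI)
  fix g assume "g * u = \<zero>\<^bsub>ring_as_module laurent_ring\<^esub>"
  moreover have "g * u * v = g" using assms by (simp add: mult.assoc mult.commute[of u v])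
  ultimately have "g = 0" by (metis mult_zero_left ring_as_module_simps(2))
  then show "\<exists>s\<in>S. s \<odot>\<^bsub>ring_as_module R\<^esub> g = \<zero>\<^bsub>ring_as_module R\<^esub>"
    using denom_one by auto
next
  fix p
  obtain s where s: "s \<in> S" "s * (p * v) \<in> carrier R" using clear_denom by blast
  have "s * p = s * (p * v) * u" using assms by (simp add: mult.assoc)
  with s show "\<exists>s\<in>S. \<exists>g\<in>carrier (ring_as_module R). s \<odot>\<^bsub>ring_as_module laurent_ring\<^esub> p = g * u"
    unfolding ring_as_module_simps by blast
qed

lemma qcoh_twist: "qcoh (twist n :: ('k::field, _, _, _) rep)"
proof -
  have "xpow (- n) * xpow n = (1 :: 'k laurent)" by (simp add: xpow_0 flip: xpow_add)
  then show ?thesis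
    using poly_x.local_iso_mult_unit[of 1 1] poly_xinv.local_iso_mult_unit[of "xpow (- n)" "xpow n"]
    by (auto simp: qcoh_iff twist_def poly_x.ring_as_module_module poly_xinv.ring_as_module_module
        laurent.ring_as_module_module algebra_simps intro!: mod_homI)
qed

lemma is_ext_mod_extensions:
  assumes "qcoh F" "qcoh G" "is_ext G F Z"
  shows "mod_extension poly_ring_x (lmod F) (lmod (mid Z)) (lmod G) (lfun (inc Z)) (lfun (prj Z))"
    and "mod_extension laurent_ring (cmod F) (cmod (mid Z)) (cmod G) (cfun (inc Z)) (cfun (prj Z))"
    and "mod_extension poly_ring_xinv (rmod F) (rmod (mid Z)) (rmod G) (rfun (inc Z)) (rfun (prj Z))"
  using assms by (auto simp: is_ext_def qcoh_iff rep_hom_def mod_extension_def mod_extension_axioms_def)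

text \<open>
  Quasi-coherence of the middle term follows from \<open>local_iso_extension\<close>, so only the
  module structures, the exact sequences and the commuting squares have to be supplied.
\<close>

lemma is_extI:
  assumes F: "qcoh F" and G: "qcoh G"
    and l: "mod_extension poly_ring_x (lmod F) (lmod (mid Z)) (lmod G) (lfun (inc Z)) (lfun (prj Z))"
    and c: "mod_extension laurent_ring (cmod F) (cmod (mid Z)) (cmod G) (cfun (inc Z)) (cfun (prj Z))"
    and r: "mod_extension poly_ring_xinv (rmod F) (rmod (mid Z)) (rmod G) (rfun (inc Z)) (rfun (prj Z))"
    and sig: "sig (mid Z) \<in> mod_hom poly_ring_x (lmod (mid Z)) (cmod (mid Z))"
    and tau: "tau (mid Z) \<in> mod_hom poly_ring_xinv (rmod (mid Z)) (cmod (mid Z))"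
    and inc_sig: "\<And>m. m \<in> carrier (lmod F) \<Longrightarrow> cfun (inc Z) (sig F m) = sig (mid Z) (lfun (inc Z) m)"
    and inc_tau: "\<And>m. m \<in> carrier (rmod F) \<Longrightarrow> cfun (inc Z) (tau F m) = tau (mid Z) (rfun (inc Z) m)"
    and prj_sig: "\<And>m. m \<in> carrier (lmod (mid Z)) \<Longrightarrow> cfun (prj Z) (sig (mid Z) m) = sig G (lfun (prj Z) m)"
    and prj_tau: "\<And>m. m \<in> carrier (rmod (mid Z)) \<Longrightarrow> cfun (prj Z) (tau (mid Z) m) = tau G (rfun (prj Z) m)"
  shows "is_ext G F Z"
proof -
  interpret l: mod_extension poly_ring_x "lmod F" "lmod (mid Z)" "lmod G" "lfun (inc Z)" "lfun (prj Z)" by fact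
  interpret c: mod_extension laurent_ring "cmod F" "cmod (mid Z)" "cmod G" "cfun (inc Z)" "cfun (prj Z)" by fact
  interpret r: mod_extension poly_ring_xinv "rmod F" "rmod (mid Z)" "rmod G" "rfun (inc Z)" "rfun (prj Z)" by fact
  have "local_iso powers_x (lmod (mid Z)) (sig (mid Z)) (cmod (mid Z))"
    using F G by (intro poly_x.local_iso_extension[OF l c _ sig, of "sig F" "sig G"])
      (auto simp: qcoh_iff inc_sig prj_sig)
  moreover have "local_iso powers_xinv (rmod (mid Z)) (tau (mid Z)) (cmod (mid Z))"
    using F G by (intro poly_xinv.local_iso_extension[OF r c _ tau, of "tau F" "tau G"])
      (auto simp: qcoh_iff inc_tau prj_tau)
  ultimately show ?thesis
    unfolding is_ext_def qcoh_iff rep_hom_def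
    using l.E.module_axioms c.E.module_axioms r.E.module_axioms l.i_hom l.p_hom c.i_hom c.p_hom
      r.i_hom r.p_hom l.exact c.exact r.exact sig tau inc_sig inc_tau prj_sig prj_tau
    by simp
qed

locale twist_extension =
  fixes n :: int and F :: "('k::field, 'm, 'p, 'n) rep"
    and Z :: "('k, 'm, 'p, 'n, 'a, 'b, 'c, 'k laurent, 'k laurent, 'k laurent) ext"
  assumes qcoh: "qcoh F" and is_ext: "is_ext (twist n) F Z"

sublocale twist_extension \<subseteq> l: mod_extension poly_ring_x "lmod F" "lmod (mid Z)"
    "ring_as_module poly_ring_x" "lfun (inc Z)" "lfun (prj Z)"
  using is_ext_mod_extensions(1)[OF qcoh qcoh_twist is_ext] by simp

sublocale twist_extension \<subseteq> c: mod_extension laurent_ring "cmod F" "cmod (mid Z)"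
    "ring_as_module laurent_ring" "cfun (inc Z)" "cfun (prj Z)"
  using is_ext_mod_extensions(2)[OF qcoh qcoh_twist is_ext] by simp

sublocale twist_extension \<subseteq> r: mod_extension poly_ring_xinv "rmod F" "rmod (mid Z)"
    "ring_as_module poly_ring_xinv" "rfun (inc Z)" "rfun (prj Z)"
  using is_ext_mod_extensions(3)[OF qcoh qcoh_twist is_ext] by simp

text \<open>
  The elements by which the gluing class of an extension can change when other lifts of \<open>1\<close> are
  chosen, as \<open>gluing_class_iff\<close> shows.
\<close>

definition coboundaries :: "int \<Rightarrow> ('k::field, 'm, 'p, 'n) rep \<Rightarrow> 'p set" where
  "coboundaries n F = (\<lambda>m. xpow n \<odot>\<^bsub>cmod F\<^esub> sig F m) ` carrier (lmod F) <+>\<^bsub>cmod F\<^esub> tau F ` carrier (rmod F)"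

lemma coboundaries_iff:
  "d \<in> coboundaries n F \<longleftrightarrow>
    (\<exists>m\<in>carrier (lmod F). \<exists>m'\<in>carrier (rmod F). d = xpow n \<odot>\<^bsub>cmod F\<^esub> sig F m \<oplus>\<^bsub>cmod F\<^esub> tau F m')"
  by (auto simp: coboundaries_def set_add_def')

lemma coboundariesI:
  "m \<in> carrier (lmod F) \<Longrightarrow> m' \<in> carrier (rmod F)
    \<Longrightarrow> xpow n \<odot>\<^bsub>cmod F\<^esub> sig F m \<oplus>\<^bsub>cmod F\<^esub> tau F m' \<in> coboundaries n F"
  by (auto simp: coboundaries_iff)

lemma coboundaries_subgroup:
  assumes "qcoh F"
  shows "subgroup (coboundaries n F) (add_monoid (cmod F))"
proof -
  interpret L: module poly_ring_x "lmod F" using assms by (simp add: qcoh_iff)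
  interpret C: module laurent_ring "cmod F" using assms by (simp add: qcoh_iff)
  interpret R: module poly_ring_xinv "rmod F" using assms by (simp add: qcoh_iff)
  have sig: "sig F \<in> mod_hom poly_ring_x (lmod F) (cmod F)"
    and tau: "tau F \<in> mod_hom poly_ring_xinv (rmod F) (cmod F)"
    using assms by (auto simp: qcoh_iff)
  note ab = L.M.abelian_group_axioms C.M.abelian_group_axioms R.M.abelian_group_axioms
  note [simp] = mod_hom_closed[OF sig] mod_hom_closed[OF tau] mod_hom_zero[OF sig ab(1,2)]
    mod_hom_zero[OF tau ab(3,2)]
  show ?thesis
  proof (rule group.subgroupI[OF C.M.a_group])
    show "coboundaries n F \<subseteq> carrier (add_monoid (cmod F))"
      by (auto simp: coboundaries_iff)
    show "coboundaries n F \<noteq> {}"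
      using L.M.zero_closed R.M.zero_closed by (auto simp: coboundaries_def set_add_def')
  next
    fix d assume "d \<in> coboundaries n F"
    then obtain m m' where m: "m \<in> carrier (lmod F)" "m' \<in> carrier (rmod F)"
      and d: "d = xpow n \<odot>\<^bsub>cmod F\<^esub> sig F m \<oplus>\<^bsub>cmod F\<^esub> tau F m'" by (auto simp: coboundaries_iff)
    have "\<ominus>\<^bsub>cmod F\<^esub> d = xpow n \<odot>\<^bsub>cmod F\<^esub> sig F (\<ominus>\<^bsub>lmod F\<^esub> m) \<oplus>\<^bsub>cmod F\<^esub> tau F (\<ominus>\<^bsub>rmod F\<^esub> m')"
      using m by (simp add: d mod_hom_a_inv[OF sig ab(1,2)] mod_hom_a_inv[OF tau ab(3,2)]
          C.smult_r_minus C.M.minus_add)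
    then have "\<ominus>\<^bsub>cmod F\<^esub> d \<in> coboundaries n F"
      unfolding coboundaries_iff using m L.M.a_inv_closed R.M.a_inv_closed by blast
    then show "inv\<^bsub>add_monoid (cmod F)\<^esub> d \<in> coboundaries n F"
      by (simp add: a_inv_def)
  next
    fix d d' assume "d \<in> coboundaries n F" "d' \<in> coboundaries n F"
    then obtain m m' l l' where m: "m \<in> carrier (lmod F)" "m' \<in> carrier (rmod F)"
      "l \<in> carrier (lmod F)" "l' \<in> carrier (rmod F)"
      and d: "d = xpow n \<odot>\<^bsub>cmod F\<^esub> sig F m \<oplus>\<^bsub>cmod F\<^esub> tau F m'"
      "d' = xpow n \<odot>\<^bsub>cmod F\<^esub> sig F l \<oplus>\<^bsub>cmod F\<^esub> tau F l'" by (auto simp: coboundaries_iff)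
    have "d \<oplus>\<^bsub>cmod F\<^esub> d' = xpow n \<odot>\<^bsub>cmod F\<^esub> sig F (m \<oplus>\<^bsub>lmod F\<^esub> l) \<oplus>\<^bsub>cmod F\<^esub> tau F (m' \<oplus>\<^bsub>rmod F\<^esub> l')"
      using m by (simp add: d mod_hom_add[OF sig] mod_hom_add[OF tau] C.smult_r_distr C.M.a_ac)
    then show "d \<otimes>\<^bsub>add_monoid (cmod F)\<^esub> d' \<in> coboundaries n F"
      using m by (auto simp: coboundaries_iff)
  qed
qed

lemma coboundaries_abelian_subgroup:
  assumes "qcoh F"
  shows "abelian_subgroup (coboundaries n F) (cmod F)"
  using assms coboundaries_subgroup[OF assms]
  by (intro abelian_subgroupI3 additive_subgroup.intro) (auto simp: qcoh_iff dest: module.axioms)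

text \<open>
  All differences \<open>\<tau> b - x\<^sup>n \<sigma> a\<close>, read as elements of \<open>P\<close>, for lifts \<open>a\<close> and \<open>b\<close> of \<open>1\<close>.  Taking all
  pairs of lifts makes the definition free of choices.
\<close>

definition gluing_class ::
  "('k::field, 'm, 'p, 'n) rep
    \<Rightarrow> ('k, 'm, 'p, 'n, 'a, 'b, 'c, 'k laurent, 'k laurent, 'k laurent) ext \<Rightarrow> int \<Rightarrow> 'p set" where
  "gluing_class F Z n = {p \<in> carrier (cmod F). \<exists>a\<in>carrier (lmod (mid Z)). \<exists>b\<in>carrier (rmod (mid Z)).
     lfun (prj Z) a = 1 \<and> rfun (prj Z) b = 1 \<and>
     tau (mid Z) b = cfun (inc Z) p \<oplus>\<^bsub>cmod (mid Z)\<^esub> xpow n \<odot>\<^bsub>cmod (mid Z)\<^esub> sig (mid Z) a}"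

lemma gluing_classI:
  assumes "p \<in> carrier (cmod F)" "a \<in> carrier (lmod (mid Z))" "b \<in> carrier (rmod (mid Z))"
    "lfun (prj Z) a = 1" "rfun (prj Z) b = 1"
    "tau (mid Z) b = cfun (inc Z) p \<oplus>\<^bsub>cmod (mid Z)\<^esub> xpow n \<odot>\<^bsub>cmod (mid Z)\<^esub> sig (mid Z) a"
  shows "p \<in> gluing_class F Z n"
  using assms by (auto simp: gluing_class_def)

lemma gluing_classE:
  assumes "p \<in> gluing_class F Z n"
  obtains a b where "p \<in> carrier (cmod F)" "a \<in> carrier (lmod (mid Z))" "b \<in> carrier (rmod (mid Z))"
    "lfun (prj Z) a = 1" "rfun (prj Z) b = 1"
    "tau (mid Z) b = cfun (inc Z) p \<oplus>\<^bsub>cmod (mid Z)\<^esub> xpow n \<odot>\<^bsub>cmod (mid Z)\<^esub> sig (mid Z) a"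
  using assms by (auto simp: gluing_class_def)

context twist_extension
begin

lemma sig_F: "sig F \<in> mod_hom poly_ring_x (lmod F) (cmod F)"
  and tau_F: "tau F \<in> mod_hom poly_ring_xinv (rmod F) (cmod F)"
  using qcoh by (auto simp: qcoh_iff)

lemma sig_mid: "sig (mid Z) \<in> mod_hom poly_ring_x (lmod (mid Z)) (cmod (mid Z))"
  and tau_mid: "tau (mid Z) \<in> mod_hom poly_ring_xinv (rmod (mid Z)) (cmod (mid Z))"
  using is_ext by (auto simp: is_ext_def qcoh_iff)

lemma commute:
  shows inc_sig: "m \<in> carrier (lmod F) \<Longrightarrow> sig (mid Z) (lfun (inc Z) m) = cfun (inc Z) (sig F m)"
    and inc_tau: "m' \<in> carrier (rmod F) \<Longrightarrow> tau (mid Z) (rfun (inc Z) m') = cfun (inc Z) (tau F m')"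
    and prj_sig: "a \<in> carrier (lmod (mid Z)) \<Longrightarrow> cfun (prj Z) (sig (mid Z) a) = lfun (prj Z) a"
    and prj_tau: "b \<in> carrier (rmod (mid Z)) \<Longrightarrow> cfun (prj Z) (tau (mid Z) b) = rfun (prj Z) b * xpow n"
  using is_ext by (auto simp: is_ext_def rep_hom_def)

lemma gluing_class_subset: "gluing_class F Z n \<subseteq> carrier (cmod F)"
  by (auto simp: gluing_class_def)

text \<open>
  The elements \<open>\<tau> b\<close> and \<open>x\<^sup>n \<sigma> a\<close> have the same image \<open>x\<^sup>n\<close> in \<open>\<O>(n)\<close>.
\<close>

lemma gluing_class_nonempty: "gluing_class F Z n \<noteq> {}"
proof -
  obtain a where a: "a \<in> carrier (lmod (mid Z))" "lfun (prj Z) a = 1"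
    using l.lift_E[of 1] poly_x.one_mem by auto
  obtain b where b: "b \<in> carrier (rmod (mid Z))" "rfun (prj Z) b = 1"
    using r.lift_E[of 1] poly_xinv.one_mem by auto
  have "cfun (prj Z) (tau (mid Z) b) = cfun (prj Z) (xpow n \<odot>\<^bsub>cmod (mid Z)\<^esub> sig (mid Z) a)"
    using a b by (simp add: prj_tau prj_sig c.p_smult mod_hom_closed[OF sig_mid])
  then obtain p where "p \<in> carrier (cmod F)"
    "tau (mid Z) b = cfun (inc Z) p \<oplus>\<^bsub>cmod (mid Z)\<^esub> xpow n \<odot>\<^bsub>cmod (mid Z)\<^esub> sig (mid Z) a"
    using c.same_image_E[of "tau (mid Z) b" "xpow n \<odot>\<^bsub>cmod (mid Z)\<^esub> sig (mid Z) a"] a b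
    by (auto simp: mod_hom_closed[OF sig_mid] mod_hom_closed[OF tau_mid])
  with a b show ?thesis by (auto simp: gluing_class_def)
qed

text \<open>
  Any other lifts are \<open>a' = i m + a\<close> and \<open>b' = i m' + b\<close> with \<open>m \<in> M\<close> and \<open>m' \<in> N\<close>, and they replace \<open>p\<close> by
  \<open>\<tau> m' + p - x\<^sup>n \<sigma> m\<close>.
\<close>

lemma gluing_class_iff:
  assumes p: "p \<in> gluing_class F Z n"
  shows "p' \<in> gluing_class F Z n \<longleftrightarrow> p' \<in> coboundaries n F +>\<^bsub>cmod F\<^esub> p"
proof -
  note [simp] = mod_hom_closed[OF sig_F] mod_hom_closed[OF tau_F]
    mod_hom_closed[OF sig_mid] mod_hom_closed[OF tau_mid]
  let ?P = "cmod F" and ?E = "cmod (mid Z)"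
  let ?i = "cfun (inc Z)"
  from p obtain a b where pP: "p \<in> carrier ?P"
    and a: "a \<in> carrier (lmod (mid Z))" "lfun (prj Z) a = 1"
    and b: "b \<in> carrier (rmod (mid Z))" "rfun (prj Z) b = 1"
    and eq: "tau (mid Z) b = ?i p \<oplus>\<^bsub>?E\<^esub> xpow n \<odot>\<^bsub>?E\<^esub> sig (mid Z) a"
    by (auto simp: gluing_class_def)
  have tau_b: "tau (mid Z) (rfun (inc Z) m' \<oplus>\<^bsub>rmod (mid Z)\<^esub> b)
      = ?i (tau F m' \<oplus>\<^bsub>?P\<^esub> p) \<oplus>\<^bsub>?E\<^esub> xpow n \<odot>\<^bsub>?E\<^esub> sig (mid Z) a" if "m' \<in> carrier (rmod F)" for m'
    using that a b pP by (simp add: mod_hom_add[OF tau_mid] inc_tau c.i_add c.E.M.a_assoc eq)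
  have sig_a: "xpow n \<odot>\<^bsub>?E\<^esub> sig (mid Z) (lfun (inc Z) m \<oplus>\<^bsub>lmod (mid Z)\<^esub> a)
      = ?i (xpow n \<odot>\<^bsub>?P\<^esub> sig F m) \<oplus>\<^bsub>?E\<^esub> xpow n \<odot>\<^bsub>?E\<^esub> sig (mid Z) a" if "m \<in> carrier (lmod F)" for m
    using that a by (simp add: mod_hom_add[OF sig_mid] inc_sig c.E.smult_r_distr c.i_smult)
  show ?thesis
  proof
    assume "p' \<in> gluing_class F Z n"
    then obtain a' b' where p'P: "p' \<in> carrier ?P"
      and a': "a' \<in> carrier (lmod (mid Z))" "lfun (prj Z) a' = 1"
      and b': "b' \<in> carrier (rmod (mid Z))" "rfun (prj Z) b' = 1"
      and eq': "tau (mid Z) b' = ?i p' \<oplus>\<^bsub>?E\<^esub> xpow n \<odot>\<^bsub>?E\<^esub> sig (mid Z) a'"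
      by (auto simp: gluing_class_def)
    obtain m where m: "m \<in> carrier (lmod F)" "a' = lfun (inc Z) m \<oplus>\<^bsub>lmod (mid Z)\<^esub> a"
      using l.same_image_E[of a' a] a a' by auto
    obtain m' where m': "m' \<in> carrier (rmod F)" "b' = rfun (inc Z) m' \<oplus>\<^bsub>rmod (mid Z)\<^esub> b"
      using r.same_image_E[of b' b] b b' by auto
    \<comment> \<open>Both sides are \<open>\<tau> b'\<close>, expressed through the lifts \<open>a\<close> and \<open>b\<close>.\<close>
    have "?i (tau F m' \<oplus>\<^bsub>?P\<^esub> p) \<oplus>\<^bsub>?E\<^esub> xpow n \<odot>\<^bsub>?E\<^esub> sig (mid Z) a
        = ?i (p' \<oplus>\<^bsub>?P\<^esub> xpow n \<odot>\<^bsub>?P\<^esub> sig F m) \<oplus>\<^bsub>?E\<^esub> xpow n \<odot>\<^bsub>?E\<^esub> sig (mid Z) a"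
      using eq' tau_b[OF m'(1)] sig_a[OF m(1)] m(1) p'P a(1)
      unfolding m(2) m'(2) by (simp add: c.i_add c.E.M.a_assoc)
    then have "tau F m' \<oplus>\<^bsub>?P\<^esub> p = p' \<oplus>\<^bsub>?P\<^esub> xpow n \<odot>\<^bsub>?P\<^esub> sig F m"
      using a(1) m(1) m'(1) pP p'P by (simp add: c.i_inj)
    then have "p' = (tau F m' \<oplus>\<^bsub>?P\<^esub> p) \<oplus>\<^bsub>?P\<^esub> \<ominus>\<^bsub>?P\<^esub> (xpow n \<odot>\<^bsub>?P\<^esub> sig F m)"
      using m(1) p'P by (simp add: c.L.M.a_assoc c.L.M.r_neg)
    then have "p' = (xpow n \<odot>\<^bsub>?P\<^esub> sig F (\<ominus>\<^bsub>lmod F\<^esub> m) \<oplus>\<^bsub>?P\<^esub> tau F m') \<oplus>\<^bsub>?P\<^esub> p"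
      using m(1) m'(1) pP p'P
      by (simp add: mod_hom_a_inv[OF sig_F l.L.M.abelian_group_axioms c.L.M.abelian_group_axioms]
          c.L.smult_r_minus c.L.M.a_ac c.L.M.r_neg c.L.M.r_neg1)
    then show "p' \<in> coboundaries n F +>\<^bsub>?P\<^esub> p"
      using coboundariesI[OF l.L.M.a_inv_closed[OF m(1)] m'(1)] by (auto simp: a_r_coset_def')
  next
    assume "p' \<in> coboundaries n F +>\<^bsub>?P\<^esub> p"
    then obtain m m' where m: "m \<in> carrier (lmod F)" "m' \<in> carrier (rmod F)"
      and p': "p' = (xpow n \<odot>\<^bsub>?P\<^esub> sig F m \<oplus>\<^bsub>?P\<^esub> tau F m') \<oplus>\<^bsub>?P\<^esub> p"
      by (auto simp: a_r_coset_def' coboundaries_iff)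
    have p'': "tau F m' \<oplus>\<^bsub>?P\<^esub> p = p' \<oplus>\<^bsub>?P\<^esub> xpow n \<odot>\<^bsub>?P\<^esub> sig F (\<ominus>\<^bsub>lmod F\<^esub> m)"
      using m pP
      by (simp add: p' mod_hom_a_inv[OF sig_F l.L.M.abelian_group_axioms c.L.M.abelian_group_axioms]
          c.L.smult_r_minus c.L.M.a_ac c.L.M.r_neg c.L.M.r_neg1 c.L.M.r_neg2)
    have "tau (mid Z) (rfun (inc Z) m' \<oplus>\<^bsub>rmod (mid Z)\<^esub> b) = ?i p' \<oplus>\<^bsub>?E\<^esub>
        xpow n \<odot>\<^bsub>?E\<^esub> sig (mid Z) (lfun (inc Z) (\<ominus>\<^bsub>lmod F\<^esub> m) \<oplus>\<^bsub>lmod (mid Z)\<^esub> a)"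
      unfolding tau_b[OF m(2)] p'' sig_a[OF l.L.M.a_inv_closed[OF m(1)]]
      using m pP a by (simp add: c.i_add c.E.M.a_assoc p')
    moreover have "lfun (prj Z) (lfun (inc Z) (\<ominus>\<^bsub>lmod F\<^esub> m) \<oplus>\<^bsub>lmod (mid Z)\<^esub> a) = 1"
      "rfun (prj Z) (rfun (inc Z) m' \<oplus>\<^bsub>rmod (mid Z)\<^esub> b) = 1"
      using m a b by (auto simp: l.p_add r.p_add)
    moreover have "p' \<in> carrier ?P" using m pP by (simp add: p')
    ultimately show "p' \<in> gluing_class F Z n"
      using m a b unfolding gluing_class_def by blast
  qed
qed

lemma gluing_class_eq:
  assumes "p \<in> gluing_class F Z n"
  shows "gluing_class F Z n = coboundaries n F +>\<^bsub>cmod F\<^esub> p"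
  using gluing_class_iff[OF assms] by blast

end

lemma gluing_class_eq_if_meet:
  assumes "twist_extension n F Z" "twist_extension n F W"
    and "p \<in> gluing_class F Z n" "p \<in> gluing_class F W n"
  shows "gluing_class F Z n = gluing_class F W n"
  using assms twist_extension.gluing_class_eq by metis

section \<open>The gluing class determines the extension\<close>

text \<open>
  Use \<open>a\<close>, \<open>\<sigma> a\<close> and \<open>b\<close> as lifts of \<open>1\<close> in the three components, and likewise for the other extension.  The
  isomorphisms matching these lifts form a morphism of representations: since homomorphisms out of
  a component are determined on the submodule and on the lift, it suffices to compare \<open>\<sigma>\<close> at \<open>a\<close>, which
  is trivial, and \<open>\<tau>\<close> at \<open>b\<close>, where \<open>\<tau> b = i p + x\<^sup>n \<sigma> a\<close> is mapped to \<open>i' p + x\<^sup>n \<sigma>' a' = \<tau>' b'\<close>.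
\<close>

lemma ext_equiv_if_common_gluing:
  assumes "twist_extension n F Z" "twist_extension n F W"
    and p: "p \<in> gluing_class F Z n" "p \<in> gluing_class F W n"
  shows "ext_equiv F Z W"
proof -
  interpret Z: twist_extension n F Z by fact
  interpret W: twist_extension n F W by fact
  from p(1) obtain a b where a: "a \<in> carrier (lmod (mid Z))" "lfun (prj Z) a = 1"
    and b: "b \<in> carrier (rmod (mid Z))" "rfun (prj Z) b = 1"
    and ab: "tau (mid Z) b = cfun (inc Z) p \<oplus>\<^bsub>cmod (mid Z)\<^esub> xpow n \<odot>\<^bsub>cmod (mid Z)\<^esub> sig (mid Z) a"
    and pF: "p \<in> carrier (cmod F)"
    by (auto simp: gluing_class_def)
  from p(2) obtain a' b' where a': "a' \<in> carrier (lmod (mid W))" "lfun (prj W) a' = 1"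
    and b': "b' \<in> carrier (rmod (mid W))" "rfun (prj W) b' = 1"
    and ab': "tau (mid W) b' = cfun (inc W) p \<oplus>\<^bsub>cmod (mid W)\<^esub> xpow n \<odot>\<^bsub>cmod (mid W)\<^esub> sig (mid W) a'"
    by (auto simp: gluing_class_def)
  note [simp] = mod_hom_closed[OF Z.sig_mid] mod_hom_closed[OF Z.tau_mid]
    mod_hom_closed[OF W.sig_mid] mod_hom_closed[OF W.tau_mid]
  interpret Zl: free_extension poly_ring_x "lmod F" "lmod (mid Z)" "lfun (inc Z)" "lfun (prj Z)" a
    using a by unfold_locales auto
  interpret Wl: free_extension poly_ring_x "lmod F" "lmod (mid W)" "lfun (inc W)" "lfun (prj W)" a'
    using a' by unfold_locales auto
  interpret Zc: free_extension laurent_ring "cmod F" "cmod (mid Z)" "cfun (inc Z)" "cfun (prj Z)" "sig (mid Z) a"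
    using a by unfold_locales (auto simp: Z.prj_sig)
  interpret Wc: free_extension laurent_ring "cmod F" "cmod (mid W)" "cfun (inc W)" "cfun (prj W)" "sig (mid W) a'"
    using a' by unfold_locales (auto simp: W.prj_sig)
  interpret Zr: free_extension poly_ring_xinv "rmod F" "rmod (mid Z)" "rfun (inc Z)" "rfun (prj Z)" b
    using b by unfold_locales auto
  interpret Wr: free_extension poly_ring_xinv "rmod F" "rmod (mid W)" "rfun (inc W)" "rfun (prj W)" b'
    using b' by unfold_locales auto
  obtain hl where hl: "hl \<in> mod_hom poly_ring_x (lmod (mid Z)) (lmod (mid W))"
    "bij_betw hl (carrier (lmod (mid Z))) (carrier (lmod (mid W)))"
    "\<And>m. m \<in> carrier (lmod F) \<Longrightarrow> hl (lfun (inc Z) m) = lfun (inc W) m"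
    "\<And>e. e \<in> carrier (lmod (mid Z)) \<Longrightarrow> lfun (prj W) (hl e) = lfun (prj Z) e" "hl a = a'"
    using free_extension_iso[OF Zl.free_extension_axioms Wl.free_extension_axioms] by blast
  obtain hc where hc: "hc \<in> mod_hom laurent_ring (cmod (mid Z)) (cmod (mid W))"
    "bij_betw hc (carrier (cmod (mid Z))) (carrier (cmod (mid W)))"
    "\<And>m. m \<in> carrier (cmod F) \<Longrightarrow> hc (cfun (inc Z) m) = cfun (inc W) m"
    "\<And>e. e \<in> carrier (cmod (mid Z)) \<Longrightarrow> cfun (prj W) (hc e) = cfun (prj Z) e"
    "hc (sig (mid Z) a) = sig (mid W) a'"
    using free_extension_iso[OF Zc.free_extension_axioms Wc.free_extension_axioms] by blast
  obtain hr where hr: "hr \<in> mod_hom poly_ring_xinv (rmod (mid Z)) (rmod (mid W))"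
    "bij_betw hr (carrier (rmod (mid Z))) (carrier (rmod (mid W)))"
    "\<And>m. m \<in> carrier (rmod F) \<Longrightarrow> hr (rfun (inc Z) m) = rfun (inc W) m"
    "\<And>e. e \<in> carrier (rmod (mid Z)) \<Longrightarrow> rfun (prj W) (hr e) = rfun (prj Z) e" "hr b = b'"
    using free_extension_iso[OF Zr.free_extension_axioms Wr.free_extension_axioms] by blast
  have l: "hc (sig (mid Z) e) = sig (mid W) (hl e)" if e: "e \<in> carrier (lmod (mid Z))" for e
    by (rule Zl.hom_eqI[OF mod_hom_comp[OF Z.sig_mid poly_x.restrict_mod_hom[OF hc(1)]]
          mod_hom_comp[OF hl(1) W.sig_mid] _ _ e])
      (simp_all add: hl(3,5) hc(3,5) Z.inc_sig W.inc_sig mod_hom_closed[OF Z.sig_F])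
  have "hc (tau (mid Z) b) = tau (mid W) (hr b)"
    using a pF by (simp add: hr(5) ab ab' mod_hom_add[OF hc(1)] mod_hom_smult[OF hc(1)] hc(3,5))
  then have r: "hc (tau (mid Z) e) = tau (mid W) (hr e)" if e: "e \<in> carrier (rmod (mid Z))" for e
    by (intro Zr.hom_eqI[OF mod_hom_comp[OF Z.tau_mid poly_xinv.restrict_mod_hom[OF hc(1)]]
          mod_hom_comp[OF hr(1) W.tau_mid] _ _ e])
      (simp_all add: hr(3) hc(3) Z.inc_tau W.inc_tau mod_hom_closed[OF Z.tau_F])
  let ?h = "\<lparr>lfun = hl, cfun = hc, rfun = hr\<rparr>"
  have "?h \<in> rep_iso (mid Z) (mid W)"
    using hl(1,2) hc(1,2) hr(1,2) l r by (simp add: rep_iso_def rep_hom_def)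
  then show ?thesis
    unfolding ext_equiv_def using hl(3,4) hc(3,4) hr(3,4) by (intro bexI[of _ ?h]) simp_all
qed

lemma ext_equiv_iff_gluing_class:
  assumes "twist_extension n F Z" "twist_extension n F W"
  shows "ext_equiv F Z W \<longleftrightarrow> gluing_class F Z n = gluing_class F W n"
proof -
  interpret Z: twist_extension n F Z by fact
  interpret W: twist_extension n F W by fact
  obtain p where p: "p \<in> gluing_class F Z n" using Z.gluing_class_nonempty by blast
  show ?thesis
  proof
    assume "ext_equiv F Z W"
    then obtain h where h: "h \<in> rep_iso (mid Z) (mid W)"
      and inc: "\<And>m. m \<in> carrier (cmod F) \<Longrightarrow> cfun h (cfun (inc Z) m) = cfun (inc W) m"
      and prj: "\<And>e. e \<in> carrier (lmod (mid Z)) \<Longrightarrow> lfun (prj W) (lfun h e) = lfun (prj Z) e"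
        "\<And>e. e \<in> carrier (rmod (mid Z)) \<Longrightarrow> rfun (prj W) (rfun h e) = rfun (prj Z) e"
      unfolding ext_equiv_def by blast
    from h have hl: "lfun h \<in> mod_hom poly_ring_x (lmod (mid Z)) (lmod (mid W))"
      and hc: "cfun h \<in> mod_hom laurent_ring (cmod (mid Z)) (cmod (mid W))"
      and hr: "rfun h \<in> mod_hom poly_ring_xinv (rmod (mid Z)) (rmod (mid W))"
      and sig: "\<And>m. m \<in> carrier (lmod (mid Z)) \<Longrightarrow> sig (mid W) (lfun h m) = cfun h (sig (mid Z) m)"
      and tau: "\<And>m. m \<in> carrier (rmod (mid Z)) \<Longrightarrow> tau (mid W) (rfun h m) = cfun h (tau (mid Z) m)"
      by (auto simp: rep_iso_def rep_hom_def)
    from p obtain a b where a: "a \<in> carrier (lmod (mid Z))" "lfun (prj Z) a = 1"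
      and b: "b \<in> carrier (rmod (mid Z))" "rfun (prj Z) b = 1"
      and ab: "tau (mid Z) b = cfun (inc Z) p \<oplus>\<^bsub>cmod (mid Z)\<^esub> xpow n \<odot>\<^bsub>cmod (mid Z)\<^esub> sig (mid Z) a"
      and pF: "p \<in> carrier (cmod F)"
      by (auto simp: gluing_class_def)
    have "tau (mid W) (rfun h b) =
        cfun (inc W) p \<oplus>\<^bsub>cmod (mid W)\<^esub> xpow n \<odot>\<^bsub>cmod (mid W)\<^esub> sig (mid W) (lfun h a)"
      using a b pF
      by (simp add: sig tau ab mod_hom_add[OF hc] mod_hom_smult[OF hc] mod_hom_closed[OF Z.sig_mid] inc)
    then have "p \<in> gluing_class F W n"
      using pF a b prj mod_hom_closed[OF hl a(1)] mod_hom_closed[OF hr b(1)]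
      by (intro gluing_classI[of _ _ "lfun h a" _ "rfun h b"]) simp_all
    then show "gluing_class F Z n = gluing_class F W n"
      using gluing_class_eq_if_meet[OF assms p] by blast
  next
    assume "gluing_class F Z n = gluing_class F W n"
    then show "ext_equiv F Z W" using ext_equiv_if_common_gluing[OF assms p] p by simp
  qed
qed

section \<open>Every class is realised\<close>

lemma dsum_mod_simps [simp]:
  "carrier (dsum_mod M N) = carrier M \<times> carrier N"
  "zero (dsum_mod M N) = (\<zero>\<^bsub>M\<^esub>, \<zero>\<^bsub>N\<^esub>)"
  "(a, b) \<oplus>\<^bsub>dsum_mod M N\<^esub> (a', b') = (a \<oplus>\<^bsub>M\<^esub> a', b \<oplus>\<^bsub>N\<^esub> b')"
  "r \<odot>\<^bsub>dsum_mod M N\<^esub> (a, b) = (r \<odot>\<^bsub>M\<^esub> a, r \<odot>\<^bsub>N\<^esub> b)"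
  by (simp_all add: dsum_mod_def)

lemma dsum_mod_module:
  assumes "module R M" "module R N"
  shows "module R (dsum_mod M N)"
proof -
  interpret M: module R M by fact
  interpret N: module R N by fact
  show ?thesis
  proof (rule moduleI[OF M.R.is_cring])
    show "abelian_group (dsum_mod M N)"
    proof (rule abelian_groupI)
      fix x assume "x \<in> carrier (dsum_mod M N)"
      then obtain a b where "x = (a, b)" "a \<in> carrier M" "b \<in> carrier N" by auto
      then show "\<exists>y\<in>carrier (dsum_mod M N). y \<oplus>\<^bsub>dsum_mod M N\<^esub> x = \<zero>\<^bsub>dsum_mod M N\<^esub>"
        by (intro bexI[of _ "(\<ominus>\<^bsub>M\<^esub> a, \<ominus>\<^bsub>N\<^esub> b)"]) (auto simp: M.M.l_neg N.M.l_neg)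
    qed (auto simp: M.M.a_ac N.M.a_ac)
  qed (auto simp: M.smult_l_distr N.smult_l_distr M.smult_r_distr N.smult_r_distr
      M.smult_assoc1 N.smult_assoc1)
qed

lemma dsum_mod_extension:
  assumes "module R M" "module R N"
  shows "mod_extension R M (dsum_mod M N) N (\<lambda>m. (m, \<zero>\<^bsub>N\<^esub>)) snd"
proof -
  interpret M: module R M by fact
  interpret N: module R N by fact
  have "short_exact M (\<lambda>m. (m, \<zero>\<^bsub>N\<^esub>)) (dsum_mod M N) snd N"
    unfolding short_exact_def dsum_mod_simps using M.M.zero_closed N.M.zero_closed
    by (intro conjI) (auto simp: inj_on_def image_iff)
  moreover have "(\<lambda>m. (m, \<zero>\<^bsub>N\<^esub>)) \<in> mod_hom R M (dsum_mod M N)"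
    by (rule mod_homI) auto
  moreover have "snd \<in> mod_hom R (dsum_mod M N) N"
    by (rule mod_homI) auto
  ultimately show ?thesis
    using assms dsum_mod_module[OF assms]
    by (simp add: mod_extension_def mod_extension_axioms_def)
qed

text \<open>
  The split extension with its right-hand structure map replaced by \<open>t\<close>.  With \<open>t\<close> as a parameter,
  restricted only on the carrier below, the split extension itself is an instance: its map
  agrees with the one for \<open>p = 0\<close> on the carrier, but need not be equal to it elsewhere.
\<close>

definition glued_ext where
  "glued_ext n F t = (split_ext (twist n) F)\<lparr>mid := (dsum_rep F (twist n))\<lparr>tau := t\<rparr>\<rparr>"

lemma split_ext_glued:
  "split_ext (twist n) F = glued_ext n F (map_prod (tau F) (tau (twist n)))"
  by (simp add: glued_ext_def split_ext_def dsum_rep_def)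

text \<open>
  The lifts \<open>(0, 1)\<close> give \<open>\<tau> (0, 1) = (p, x\<^sup>n) = i p + x\<^sup>n \<sigma> (0, 1)\<close>.
\<close>

lemma glued_ext_gluing_class:
  assumes F: "qcoh F" and p: "p \<in> carrier (cmod F)"
    and t: "\<And>m g. m \<in> carrier (rmod F) \<Longrightarrow> g \<in> carrier poly_ring_xinv
      \<Longrightarrow> t (m, g) = (tau F m \<oplus>\<^bsub>cmod F\<^esub> g \<odot>\<^bsub>cmod F\<^esub> p, g * xpow n)"
  shows "twist_extension n F (glued_ext n F t)" and "p \<in> gluing_class F (glued_ext n F t) n"
proof -
  interpret L: module poly_ring_x "lmod F" using F by (simp add: qcoh_iff)
  interpret C: module laurent_ring "cmod F" using F by (simp add: qcoh_iff)
  interpret R: module poly_ring_xinv "rmod F" using F by (simp add: qcoh_iff)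
  have sig: "sig F \<in> mod_hom poly_ring_x (lmod F) (cmod F)"
    and tau: "tau F \<in> mod_hom poly_ring_xinv (rmod F) (cmod F)"
    using F by (auto simp: qcoh_iff)
  note ab = L.M.abelian_group_axioms C.M.abelian_group_axioms R.M.abelian_group_axioms
  note [simp] = mod_hom_closed[OF sig] mod_hom_closed[OF tau] mod_hom_zero[OF sig ab(1,2)]
    mod_hom_zero[OF tau ab(3,2)]
  have smult_p: "(f + g) \<odot>\<^bsub>cmod F\<^esub> p = f \<odot>\<^bsub>cmod F\<^esub> p \<oplus>\<^bsub>cmod F\<^esub> g \<odot>\<^bsub>cmod F\<^esub> p"
    "(f * g) \<odot>\<^bsub>cmod F\<^esub> p = f \<odot>\<^bsub>cmod F\<^esub> (g \<odot>\<^bsub>cmod F\<^esub> p)" "0 \<odot>\<^bsub>cmod F\<^esub> p = \<zero>\<^bsub>cmod F\<^esub>" for f g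
    using C.smult_l_distr[of f g p] C.smult_assoc1[of f g p] C.smult_l_null[of p] p by simp_all
  note rings = poly_x.add_mem poly_x.mult_mem poly_x.zero_mem poly_x.one_mem
    poly_xinv.add_mem poly_xinv.mult_mem poly_xinv.zero_mem poly_xinv.one_mem
  have sel: "lmod (mid (glued_ext n F t)) = dsum_mod (lmod F) (ring_as_module poly_ring_x)"
    "cmod (mid (glued_ext n F t)) = dsum_mod (cmod F) (ring_as_module laurent_ring)"
    "rmod (mid (glued_ext n F t)) = dsum_mod (rmod F) (ring_as_module poly_ring_xinv)"
    "sig (mid (glued_ext n F t)) = map_prod (sig F) (\<lambda>f. f)"
    "tau (mid (glued_ext n F t)) = t"
    "lfun (inc (glued_ext n F t)) = (\<lambda>m. (m, 0))" "cfun (inc (glued_ext n F t)) = (\<lambda>m. (m, 0))"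
    "rfun (inc (glued_ext n F t)) = (\<lambda>m. (m, 0))"
    "lfun (prj (glued_ext n F t)) = snd" "cfun (prj (glued_ext n F t)) = snd"
    "rfun (prj (glued_ext n F t)) = snd"
    by (simp_all add: glued_ext_def split_ext_def dsum_rep_def twist_def)
  have "is_ext (twist n) F (glued_ext n F t)"
  proof (rule is_extI[OF F qcoh_twist])
    show "sig (mid (glued_ext n F t)) \<in> mod_hom poly_ring_x (lmod (mid (glued_ext n F t)))
        (cmod (mid (glued_ext n F t)))"
      unfolding sel by (rule mod_homI) (auto simp: mod_hom_add[OF sig] mod_hom_smult[OF sig])
    show "tau (mid (glued_ext n F t)) \<in> mod_hom poly_ring_xinv (rmod (mid (glued_ext n F t)))
        (cmod (mid (glued_ext n F t)))"
      unfolding sel using p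
      by (intro mod_homI)
        (auto simp: t rings mod_hom_add[OF tau] mod_hom_smult[OF tau] smult_p C.smult_r_distr
          C.M.a_ac algebra_simps)
  qed (use p in \<open>auto simp: sel t rings smult_p L.module_axioms C.module_axioms R.module_axioms
      poly_x.ring_as_module_module poly_xinv.ring_as_module_module laurent.ring_as_module_module
      intro: dsum_mod_extension[where N = "ring_as_module _", simplified]\<close>)
  then show "twist_extension n F (glued_ext n F t)" using F by unfold_locales
  have "1 \<odot>\<^bsub>cmod F\<^esub> p = p" using C.smult_one[OF p] by simp
  then show "p \<in> gluing_class F (glued_ext n F t) n"
    using p rings t[OF R.M.zero_closed poly_xinv.one_mem]
    by (intro gluing_classI[of _ _ "(\<zero>\<^bsub>lmod F\<^esub>, 1)" _ "(\<zero>\<^bsub>rmod F\<^esub>, 1)"]) (simp_all add: sel)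
qed

lemma split_ext_gluing_class:
  assumes F: "qcoh F"
  shows "twist_extension n F (split_ext (twist n) F)"
    and "\<zero>\<^bsub>cmod F\<^esub> \<in> gluing_class F (split_ext (twist n) F) n"
proof -
  interpret C: module laurent_ring "cmod F" using F by (simp add: qcoh_iff)
  have "tau F \<in> mod_hom poly_ring_xinv (rmod F) (cmod F)" using F by (simp add: qcoh_iff)
  then have t: "map_prod (tau F) (tau (twist n)) (m, g)
      = (tau F m \<oplus>\<^bsub>cmod F\<^esub> g \<odot>\<^bsub>cmod F\<^esub> \<zero>\<^bsub>cmod F\<^esub>, g * xpow n)" if "m \<in> carrier (rmod F)" for m g
    using that by (simp add: mod_hom_closed)
  show "twist_extension n F (split_ext (twist n) F)"
    "\<zero>\<^bsub>cmod F\<^esub> \<in> gluing_class F (split_ext (twist n) F) n"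
    unfolding split_ext_glued by (rule glued_ext_gluing_class[OF F C.M.zero_closed t]; assumption)+
qed

text \<open>
  Extensions counted by \<open>Ext1\<close> have their carriers inside given types, so the middle
  terms constructed above have to be moved along injections.
\<close>

definition transport_module :: "('b \<Rightarrow> 'c) \<Rightarrow> ('r, 'b) module \<Rightarrow> ('r, 'c) module" where
  "transport_module f M = (let g = inv_into (carrier M) f in
     mk_module (f ` carrier M) (f \<zero>\<^bsub>M\<^esub>) (\<lambda>x y. f (g x \<oplus>\<^bsub>M\<^esub> g y)) (\<lambda>r x. f (r \<odot>\<^bsub>M\<^esub> g x)))"

lemma transport_module:
  assumes M: "module R M" and f: "inj_on f (carrier M)"
  defines "g \<equiv> inv_into (carrier M) f"
  shows transport_module_module: "module R (transport_module f M)"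
    and transport_module_to: "f \<in> mod_hom R M (transport_module f M)"
    and transport_module_from: "g \<in> mod_hom R (transport_module f M) M"
proof -
  interpret M: module R M by fact
  have [simp]: "g (f m) = m" if "m \<in> carrier M" for m
    using that f by (simp add: g_def)
  have [simp]: "carrier (transport_module f M) = f ` carrier M"
    "zero (transport_module f M) = f \<zero>\<^bsub>M\<^esub>"
    "x \<oplus>\<^bsub>transport_module f M\<^esub> y = f (g x \<oplus>\<^bsub>M\<^esub> g y)"
    "r \<odot>\<^bsub>transport_module f M\<^esub> x = f (r \<odot>\<^bsub>M\<^esub> g x)" for x y r
    by (simp_all add: transport_module_def g_def Let_def)
  show "module R (transport_module f M)"
  proof (rule moduleI[OF M.R.is_cring])
    show "abelian_group (transport_module f M)"
    proof (rule abelian_groupI)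
      fix x assume "x \<in> carrier (transport_module f M)"
      then obtain m where "x = f m" "m \<in> carrier M" by auto
      then show "\<exists>y\<in>carrier (transport_module f M).
          y \<oplus>\<^bsub>transport_module f M\<^esub> x = \<zero>\<^bsub>transport_module f M\<^esub>"
        by (auto intro!: bexI[of _ "\<ominus>\<^bsub>M\<^esub> m"] simp: M.M.l_neg)
    qed (auto simp: M.M.a_ac)
  qed (auto simp: M.smult_l_distr M.smult_r_distr M.smult_assoc1)
  show "f \<in> mod_hom R M (transport_module f M)" "g \<in> mod_hom R (transport_module f M) M"
    by (auto intro!: mod_homI)
qed

lemma transport_extension:
  assumes "mod_extension R L E Q i p" and f: "inj_on f (carrier E)"
  shows "mod_extension R L (transport_module f E) Q (\<lambda>l. f (i l)) (\<lambda>x. p (inv_into (carrier E) f x))"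
proof -
  interpret mod_extension R L E Q i p by fact
  note tr = transport_module[OF E.module_axioms f]
  have c: "carrier (transport_module f E) = f ` carrier E"
    by (simp add: transport_module_def Let_def)
  have "short_exact L (\<lambda>l. f (i l)) (transport_module f E) (\<lambda>x. p (inv_into (carrier E) f x)) Q"
    unfolding short_exact_def
  proof (intro conjI)
    show "inj_on (\<lambda>l. f (i l)) (carrier L)"
      using f by (intro inj_onI) (metis i_closed i_inj inj_onD)
    have "(\<lambda>l. f (i l)) ` carrier L = f ` {e \<in> carrier E. p e = \<zero>\<^bsub>Q\<^esub>}"
      using exact by (simp add: short_exact_def image_image flip: image_image[of f i])
    then show "(\<lambda>l. f (i l)) ` carrier L =
        {e \<in> carrier (transport_module f E). p (inv_into (carrier E) f e) = \<zero>\<^bsub>Q\<^esub>}"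
      using f by (auto simp: c)
    show "(\<lambda>x. p (inv_into (carrier E) f x)) ` carrier (transport_module f E) = carrier Q"
      using f exact by (auto simp: c short_exact_def image_image)
  qed
  then show ?thesis
    unfolding mod_extension_def mod_extension_axioms_def
    using L.module_axioms Q.module_axioms tr mod_hom_comp[OF i_hom tr(2)] mod_hom_comp[OF tr(3) p_hom]
    by blast
qed

lemma transport_twist_extension:
  fixes Z :: "('k::field, 'm, 'p, 'n, 'd, 'e, 'f, 'k laurent, 'k laurent, 'k laurent) ext"
    and fl :: "'d \<Rightarrow> 'a" and fc :: "'e \<Rightarrow> 'b" and fr :: "'f \<Rightarrow> 'c"
  assumes "twist_extension n F Z"
    and fl: "inj_on fl (carrier (lmod (mid Z)))" and fc: "inj_on fc (carrier (cmod (mid Z)))"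
    and fr: "inj_on fr (carrier (rmod (mid Z)))" and p: "p \<in> gluing_class F Z n"
  obtains W :: "('k, 'm, 'p, 'n, 'a, 'b, 'c, 'k laurent, 'k laurent, 'k laurent) ext"
  where "twist_extension n F W" "p \<in> gluing_class F W n"
proof -
  interpret Z: twist_extension n F Z by fact
  note l = transport_module[OF Z.l.E.module_axioms fl] transport_extension[OF Z.l.mod_extension_axioms fl]
  note c = transport_module[OF Z.c.E.module_axioms fc] transport_extension[OF Z.c.mod_extension_axioms fc]
  note r = transport_module[OF Z.r.E.module_axioms fr] transport_extension[OF Z.r.mod_extension_axioms fr]
  define gl where "gl = inv_into (carrier (lmod (mid Z))) fl"
  define gc where "gc = inv_into (carrier (cmod (mid Z))) fc"
  define gr where "gr = inv_into (carrier (rmod (mid Z))) fr"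
  note l = l[folded gl_def] and c = c[folded gc_def] and r = r[folded gr_def]
  have [simp]: "\<And>e. e \<in> carrier (lmod (mid Z)) \<Longrightarrow> gl (fl e) = e"
    "\<And>e. e \<in> carrier (cmod (mid Z)) \<Longrightarrow> gc (fc e) = e"
    "\<And>e. e \<in> carrier (rmod (mid Z)) \<Longrightarrow> gr (fr e) = e"
    using fl fc fr by (simp_all add: gl_def gc_def gr_def)
  note [simp] = mod_hom_closed[OF Z.sig_mid] mod_hom_closed[OF Z.tau_mid] mod_hom_closed[OF l(2)]
    mod_hom_closed[OF l(3)] mod_hom_closed[OF c(2)] mod_hom_closed[OF r(2)] mod_hom_closed[OF r(3)]
  define W :: "('k, 'm, 'p, 'n, 'a, 'b, 'c, 'k laurent, 'k laurent, 'k laurent) ext" where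
    "W = \<lparr>mid = \<lparr>lmod = transport_module fl (lmod (mid Z)), cmod = transport_module fc (cmod (mid Z)),
        rmod = transport_module fr (rmod (mid Z)),
        sig = (\<lambda>x. fc (sig (mid Z) (gl x))), tau = (\<lambda>x. fc (tau (mid Z) (gr x)))\<rparr>,
      inc = \<lparr>lfun = (\<lambda>m. fl (lfun (inc Z) m)), cfun = (\<lambda>m. fc (cfun (inc Z) m)),
        rfun = (\<lambda>m. fr (rfun (inc Z) m))\<rparr>,
      prj = \<lparr>lfun = (\<lambda>x. lfun (prj Z) (gl x)), cfun = (\<lambda>x. cfun (prj Z) (gc x)),
        rfun = (\<lambda>x. rfun (prj Z) (gr x))\<rparr>\<rparr>"
  have "is_ext (twist n) F W"
  proof (rule is_extI[OF Z.qcoh qcoh_twist])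
    show "sig (mid W) \<in> mod_hom poly_ring_x (lmod (mid W)) (cmod (mid W))"
      using mod_hom_comp[OF mod_hom_comp[OF l(3) Z.sig_mid] poly_x.restrict_mod_hom[OF c(2)]]
      by (simp add: W_def)
    show "tau (mid W) \<in> mod_hom poly_ring_xinv (rmod (mid W)) (cmod (mid W))"
      using mod_hom_comp[OF mod_hom_comp[OF r(3) Z.tau_mid] poly_xinv.restrict_mod_hom[OF c(2)]]
      by (simp add: W_def)
  qed (simp_all add: W_def l(4) c(4) r(4) Z.commute mod_hom_closed[OF Z.sig_F] mod_hom_closed[OF Z.tau_F])
  then have W: "twist_extension n F W" using Z.qcoh by unfold_locales
  from p obtain a b where a: "a \<in> carrier (lmod (mid Z))" "lfun (prj Z) a = 1"
    and b: "b \<in> carrier (rmod (mid Z))" "rfun (prj Z) b = 1"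
    and ab: "tau (mid Z) b = cfun (inc Z) p \<oplus>\<^bsub>cmod (mid Z)\<^esub> xpow n \<odot>\<^bsub>cmod (mid Z)\<^esub> sig (mid Z) a"
    and pF: "p \<in> carrier (cmod F)"
    by (auto simp: gluing_class_def)
  have "p \<in> gluing_class F W n"
    using a b pF by (intro gluing_classI[of _ _ "fl a" _ "fr b"])
      (simp_all add: W_def ab mod_hom_add[OF c(2)] mod_hom_smult[OF c(2)])
  with W that show ?thesis by blast
qed

text \<open>
  The cardinality assumptions provide the injections of the middle term of \<open>glued_ext\<close>, whose carriers
  are the products of the two ends, into the given types.
\<close>

lemma gluing_class_surj:
  fixes F :: "('k::field, 'm, 'p, 'n) rep"
  assumes F: "qcoh F" and p: "p \<in> carrier (cmod F)"
    and "carrier (lmod F) \<times> carrier (lmod (twist n :: ('k, _, _, _) rep)) \<lesssim> (UNIV :: 'a set)"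
    and "carrier (cmod F) \<times> carrier (cmod (twist n :: ('k, _, _, _) rep)) \<lesssim> (UNIV :: 'b set)"
    and "carrier (rmod F) \<times> carrier (rmod (twist n :: ('k, _, _, _) rep)) \<lesssim> (UNIV :: 'c set)"
  obtains W :: "('k, 'm, 'p, 'n, 'a, 'b, 'c, 'k laurent, 'k laurent, 'k laurent) ext"
  where "twist_extension n F W" "p \<in> gluing_class F W n"
proof -
  define Z where "Z = glued_ext n F (\<lambda>(m, g). (tau F m \<oplus>\<^bsub>cmod F\<^esub> g \<odot>\<^bsub>cmod F\<^esub> p, g * xpow n))"
  have Z: "twist_extension n F Z" "p \<in> gluing_class F Z n"
    using glued_ext_gluing_class[OF F p] by (simp_all add: Z_def)
  have eq: "carrier (lmod (mid Z)) = carrier (lmod F) \<times> carrier (lmod (twist n :: ('k, _, _, _) rep))"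
    "carrier (cmod (mid Z)) = carrier (cmod F) \<times> carrier (cmod (twist n :: ('k, _, _, _) rep))"
    "carrier (rmod (mid Z)) = carrier (rmod F) \<times> carrier (rmod (twist n :: ('k, _, _, _) rep))"
    by (simp_all add: Z_def glued_ext_def split_ext_def dsum_rep_def)
  obtain fl :: "_ \<Rightarrow> 'a" where fl: "inj_on fl (carrier (lmod (mid Z)))"
    using assms(3) unfolding lepoll_def eq by blast
  obtain fc :: "_ \<Rightarrow> 'b" where fc: "inj_on fc (carrier (cmod (mid Z)))"
    using assms(4) unfolding lepoll_def eq by blast
  obtain fr :: "_ \<Rightarrow> 'c" where fr: "inj_on fr (carrier (rmod (mid Z)))"
    using assms(5) unfolding lepoll_def eq by blast
  obtain W :: "('k, 'm, 'p, 'n, 'a, 'b, 'c, 'k laurent, 'k laurent, 'k laurent) ext"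
    where "twist_extension n F W" "p \<in> gluing_class F W n"
    by (rule transport_twist_extension[OF Z(1) fl fc fr Z(2)])
  then show ?thesis by (rule that)
qed

section \<open>The Baer sum\<close>

locale baer = X: mod_extension R L E Q i p + Y: mod_extension R L E' Q i' p'
  for R :: "'r ring" and L :: "('r, 'l) module" and E :: "('r, 'e) module"
    and Q :: "('r, 'q) module" and i p and E' :: "('r, 'f) module" and i' p'
begin

abbreviation cls :: "'e \<Rightarrow> 'f \<Rightarrow> ('e \<times> 'f) set" where
  "cls \<equiv> baer_class L i E i' E'"

abbreviation B :: "('r, ('e \<times> 'f) set) module" where
  "B \<equiv> baer_mod L i E p i' E' p'"

lemma mem_cls: "(f, f') \<in> cls e e' \<longleftrightarrow> (\<exists>m\<in>carrier L. f = e \<oplus>\<^bsub>E\<^esub> i m \<and> f' = e' \<ominus>\<^bsub>E'\<^esub> i' m)"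
  by (auto simp: baer_class_def)

lemma mem_cls_self:
  assumes "e \<in> carrier E" "e' \<in> carrier E'"
  shows "(e, e') \<in> cls e e'"
  unfolding mem_cls using assms by (intro bexI[of _ "\<zero>\<^bsub>L\<^esub>"]) (auto simp: a_minus_def)

text \<open>
  Classes are cosets of the submodule of all \<open>(i m, - i' m)\<close>, so translation by such an element does not
  change them.
\<close>

lemma cls_shift:
  assumes "e \<in> carrier E" "e' \<in> carrier E'" "m \<in> carrier L"
  shows "cls (e \<oplus>\<^bsub>E\<^esub> i m) (e' \<ominus>\<^bsub>E'\<^esub> i' m) = cls e e'"
proof (intro equalityI subrelI)
  fix f f' assume "(f, f') \<in> cls (e \<oplus>\<^bsub>E\<^esub> i m) (e' \<ominus>\<^bsub>E'\<^esub> i' m)"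
  then obtain l where l: "l \<in> carrier L" "f = e \<oplus>\<^bsub>E\<^esub> i m \<oplus>\<^bsub>E\<^esub> i l" "f' = e' \<ominus>\<^bsub>E'\<^esub> i' m \<ominus>\<^bsub>E'\<^esub> i' l"
    by (auto simp: mem_cls)
  then show "(f, f') \<in> cls e e'"
    unfolding mem_cls using assms
    by (intro bexI[of _ "m \<oplus>\<^bsub>L\<^esub> l"])
      (auto simp: X.i_add Y.i_add a_minus_def X.E.M.a_assoc Y.E.M.a_assoc Y.E.M.minus_add)
next
  fix f f' assume "(f, f') \<in> cls e e'"
  then obtain l where l: "l \<in> carrier L" "f = e \<oplus>\<^bsub>E\<^esub> i l" "f' = e' \<ominus>\<^bsub>E'\<^esub> i' l"
    by (auto simp: mem_cls)
  then show "(f, f') \<in> cls (e \<oplus>\<^bsub>E\<^esub> i m) (e' \<ominus>\<^bsub>E'\<^esub> i' m)"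
    unfolding mem_cls using assms
    by (intro bexI[of _ "\<ominus>\<^bsub>L\<^esub> m \<oplus>\<^bsub>L\<^esub> l"])
      (auto simp: X.i_add Y.i_add X.i_a_inv Y.i_a_inv a_minus_def X.E.M.a_assoc Y.E.M.a_assoc
        Y.E.M.minus_add X.E.M.r_neg2 Y.E.M.r_neg1)
qed

lemma UN_cls:
  assumes "e \<in> carrier E" "e' \<in> carrier E'"
    and "\<And>m. m \<in> carrier L \<Longrightarrow> g (e \<oplus>\<^bsub>E\<^esub> i m) (e' \<ominus>\<^bsub>E'\<^esub> i' m) = c"
  shows "(\<Union>(f, f')\<in>cls e e'. g f f') = c"
  using assms(3) X.L.M.zero_closed by (auto simp: baer_class_def)

lemma B_carrier: "carrier B = {cls e e' | e e'. e \<in> carrier E \<and> e' \<in> carrier E' \<and> p e = p' e'}"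
  and B_zero: "\<zero>\<^bsub>B\<^esub> = cls \<zero>\<^bsub>E\<^esub> \<zero>\<^bsub>E'\<^esub>"
  by (simp_all add: baer_mod_def)

lemma B_carrierI: "e \<in> carrier E \<Longrightarrow> e' \<in> carrier E' \<Longrightarrow> p e = p' e' \<Longrightarrow> cls e e' \<in> carrier B"
  by (auto simp: B_carrier)

lemma B_cases:
  assumes "A \<in> carrier B"
  obtains e e' where "e \<in> carrier E" "e' \<in> carrier E'" "p e = p' e'" "A = cls e e'"
  using assms by (auto simp: B_carrier)

lemma B_add:
  assumes "e \<in> carrier E" "e' \<in> carrier E'" "f \<in> carrier E" "f' \<in> carrier E'"
  shows "cls e e' \<oplus>\<^bsub>B\<^esub> cls f f' = cls (e \<oplus>\<^bsub>E\<^esub> f) (e' \<oplus>\<^bsub>E'\<^esub> f')"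
proof -
  have "cls (e \<oplus>\<^bsub>E\<^esub> i m \<oplus>\<^bsub>E\<^esub> (f \<oplus>\<^bsub>E\<^esub> i l)) (e' \<ominus>\<^bsub>E'\<^esub> i' m \<oplus>\<^bsub>E'\<^esub> (f' \<ominus>\<^bsub>E'\<^esub> i' l))
      = cls (e \<oplus>\<^bsub>E\<^esub> f) (e' \<oplus>\<^bsub>E'\<^esub> f')" if ml: "m \<in> carrier L" "l \<in> carrier L" for m l
  proof -
    have "e \<oplus>\<^bsub>E\<^esub> i m \<oplus>\<^bsub>E\<^esub> (f \<oplus>\<^bsub>E\<^esub> i l) = e \<oplus>\<^bsub>E\<^esub> f \<oplus>\<^bsub>E\<^esub> i (m \<oplus>\<^bsub>L\<^esub> l)"
      using assms ml by (simp add: X.i_add X.E.M.a_ac)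
    moreover have "e' \<ominus>\<^bsub>E'\<^esub> i' m \<oplus>\<^bsub>E'\<^esub> (f' \<ominus>\<^bsub>E'\<^esub> i' l) = e' \<oplus>\<^bsub>E'\<^esub> f' \<ominus>\<^bsub>E'\<^esub> i' (m \<oplus>\<^bsub>L\<^esub> l)"
      using assms ml by (simp add: Y.i_add Y.E.M.a_ac a_minus_def Y.E.M.minus_add)
    ultimately show ?thesis using assms ml by (simp add: cls_shift)
  qed
  then show ?thesis
    unfolding baer_mod_def mk_module_simps using assms by (intro UN_cls) auto
qed

lemma B_smult:
  assumes "r \<in> carrier R" "e \<in> carrier E" "e' \<in> carrier E'"
  shows "r \<odot>\<^bsub>B\<^esub> cls e e' = cls (r \<odot>\<^bsub>E\<^esub> e) (r \<odot>\<^bsub>E'\<^esub> e')"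
proof -
  have "cls (r \<odot>\<^bsub>E\<^esub> (e \<oplus>\<^bsub>E\<^esub> i m)) (r \<odot>\<^bsub>E'\<^esub> (e' \<ominus>\<^bsub>E'\<^esub> i' m)) = cls (r \<odot>\<^bsub>E\<^esub> e) (r \<odot>\<^bsub>E'\<^esub> e')"
    if m: "m \<in> carrier L" for m
  proof -
    have "r \<odot>\<^bsub>E\<^esub> (e \<oplus>\<^bsub>E\<^esub> i m) = r \<odot>\<^bsub>E\<^esub> e \<oplus>\<^bsub>E\<^esub> i (r \<odot>\<^bsub>L\<^esub> m)"
      using assms m by (simp add: X.i_smult X.E.smult_r_distr)
    moreover have "r \<odot>\<^bsub>E'\<^esub> (e' \<ominus>\<^bsub>E'\<^esub> i' m) = r \<odot>\<^bsub>E'\<^esub> e' \<ominus>\<^bsub>E'\<^esub> i' (r \<odot>\<^bsub>L\<^esub> m)"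
      using assms m by (simp add: Y.i_smult Y.E.smult_r_distr a_minus_def Y.E.smult_r_minus)
    ultimately show ?thesis using assms m by (simp add: cls_shift)
  qed
  then show ?thesis
    unfolding baer_mod_def mk_module_simps using assms by (intro UN_cls) auto
qed

lemma B_module: "module R B"
proof (rule moduleI[OF module.axioms(1)[OF X.E.module_axioms]])
  show "abelian_group B"
  proof (rule abelian_groupI)
    fix A assume "A \<in> carrier B"
    then obtain e e' where "e \<in> carrier E" "e' \<in> carrier E'" "p e = p' e'" "A = cls e e'"
      by (rule B_cases)
    then show "\<exists>C\<in>carrier B. C \<oplus>\<^bsub>B\<^esub> A = \<zero>\<^bsub>B\<^esub>"
      by (intro bexI[of _ "cls (\<ominus>\<^bsub>E\<^esub> e) (\<ominus>\<^bsub>E'\<^esub> e')"])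
        (simp_all add: B_add B_zero B_carrierI X.E.M.l_neg Y.E.M.l_neg X.p_a_inv Y.p_a_inv)
  qed (auto elim!: B_cases simp: B_add B_zero X.E.M.a_ac Y.E.M.a_ac X.p_add Y.p_add intro!: B_carrierI)
qed (auto elim!: B_cases simp: B_add B_smult X.E.smult_l_distr Y.E.smult_l_distr
    X.E.smult_r_distr Y.E.smult_r_distr X.E.smult_assoc1 Y.E.smult_assoc1
    X.p_smult Y.p_smult X.p_add Y.p_add intro!: B_carrierI)

text \<open>
  In the quotient both copies of \<open>L\<close> are identified.  This gives exactness in the middle and the
  additivity of gluing classes.
\<close>

lemma cls_i_i':
  assumes "m \<in> carrier L" "m' \<in> carrier L"
  shows "cls (i m) (i' m') = cls (i (m \<oplus>\<^bsub>L\<^esub> m')) \<zero>\<^bsub>E'\<^esub>"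
  using cls_shift[of "i m" "i' m'" m'] assms by (simp add: X.i_add a_minus_def Y.E.M.r_neg)

abbreviation (input) iB :: "'l \<Rightarrow> ('e \<times> 'f) set" where
  "iB \<equiv> \<lambda>m. cls (i m) \<zero>\<^bsub>E'\<^esub>"

abbreviation (input) pB :: "('e \<times> 'f) set \<Rightarrow> 'q" where
  "pB \<equiv> \<lambda>A. the_elem ((\<lambda>(e, e'). p e) ` A)"

lemma pB_cls:
  assumes "e \<in> carrier E"
  shows "pB (cls e e') = p e"
proof -
  have "(\<lambda>(e, e'). p e) ` cls e e' = {p e}"
    using assms X.L.M.zero_closed by (force simp: baer_class_def X.p_add)
  then show ?thesis by simp
qed

lemma B_extension: "mod_extension R L B Q iB pB"
proof -
  have "iB \<in> mod_hom R L B"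
    by (rule mod_homI) (auto simp: B_add B_smult X.i_add X.i_smult intro!: B_carrierI)
  moreover have "pB \<in> mod_hom R B Q"
    by (rule mod_homI) (auto elim!: B_cases simp: B_add B_smult pB_cls X.p_add X.p_smult)
  moreover have "short_exact L iB B pB Q"
    unfolding short_exact_def
  proof (intro conjI)
    show "inj_on iB (carrier L)"
    proof (rule inj_onI)
      fix l m assume lm: "l \<in> carrier L" "m \<in> carrier L" and eq: "iB l = iB m"
      have "(i m, \<zero>\<^bsub>E'\<^esub>) \<in> iB l" using lm eq mem_cls_self by simp
      then obtain k where k: "k \<in> carrier L" "i m = i l \<oplus>\<^bsub>E\<^esub> i k" "\<zero>\<^bsub>E'\<^esub> = \<zero>\<^bsub>E'\<^esub> \<ominus>\<^bsub>E'\<^esub> i' k"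
        by (auto simp: mem_cls)
      have "i' \<zero>\<^bsub>L\<^esub> = i' k"
        using k(1,3) Y.E.M.minus_eq_zero_iff[of "\<zero>\<^bsub>E'\<^esub>" "i' k"] by simp
      then have "k = \<zero>\<^bsub>L\<^esub>" using k(1) by (simp add: Y.i_inj del: Y.i_zero)
      then show "l = m" using k(2) lm by (simp add: X.i_inj)
    qed
    show "iB ` carrier L = {A \<in> carrier B. pB A = \<zero>\<^bsub>Q\<^esub>}"
    proof
      show "iB ` carrier L \<subseteq> {A \<in> carrier B. pB A = \<zero>\<^bsub>Q\<^esub>}"
        by (auto simp: pB_cls intro!: B_carrierI)
      show "{A \<in> carrier B. pB A = \<zero>\<^bsub>Q\<^esub>} \<subseteq> iB ` carrier L"
      proof
        fix A assume "A \<in> {A \<in> carrier B. pB A = \<zero>\<^bsub>Q\<^esub>}"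
        then obtain e e' where e: "e \<in> carrier E" "e' \<in> carrier E'" "p e = \<zero>\<^bsub>Q\<^esub>" "p' e' = \<zero>\<^bsub>Q\<^esub>"
          and A: "A = cls e e'"
          by (auto simp: pB_cls elim!: B_cases)
        obtain m where m: "m \<in> carrier L" "e = i m" using X.kernel_E[OF e(1,3)] .
        obtain m' where m': "m' \<in> carrier L" "e' = i' m'" using Y.kernel_E[OF e(2,4)] .
        have "A = iB (m \<oplus>\<^bsub>L\<^esub> m')" using m m' by (simp add: A cls_i_i')
        then show "A \<in> iB ` carrier L" using m m' by blast
      qed
    qed
    show "pB ` carrier B = carrier Q"
    proof
      show "pB ` carrier B \<subseteq> carrier Q" by (auto simp: pB_cls elim!: B_cases)
      show "carrier Q \<subseteq> pB ` carrier B"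
      proof
        fix q assume q: "q \<in> carrier Q"
        obtain e where e: "e \<in> carrier E" "p e = q" using X.lift_E[OF q] .
        obtain e' where e': "e' \<in> carrier E'" "p' e' = q" using Y.lift_E[OF q] .
        have "q = pB (cls e e')" using e by (simp add: pB_cls)
        moreover have "cls e e' \<in> carrier B" using e e' by (simp add: B_carrierI)
        ultimately show "q \<in> pB ` carrier B" by blast
      qed
    qed
  qed
  ultimately show ?thesis
    using X.L.module_axioms X.Q.module_axioms B_module
    by (simp add: mod_extension_def mod_extension_axioms_def)
qed

end

text \<open>
  The structure maps \<open>\<sigma>\<close> and \<open>\<tau>\<close> of a Baer sum lead from a component over a subring to the component over \<open>k[x,x\<inverse>]\<close>,
  whence the two rings \<open>R\<close> and \<open>T\<close>.  The union is over all representatives and collapses because the maps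
  are compatible with the inclusions of \<open>L\<close> and \<open>L2\<close>.
\<close>

lemma baer_map:
  assumes "baer R L E Q i p E' i' p'" and "baer T L2 E2 Q2 i2 p2 E2' i2' p2'"
    and RT: "carrier R \<subseteq> carrier T"
    and a: "a \<in> mod_hom R L L2" and s: "s \<in> mod_hom R E E2" and s': "s' \<in> mod_hom R E' E2'"
    and si: "\<And>l. l \<in> carrier L \<Longrightarrow> s (i l) = i2 (a l)"
    and si': "\<And>l. l \<in> carrier L \<Longrightarrow> s' (i' l) = i2' (a l)"
    and ps: "\<And>e. e \<in> carrier E \<Longrightarrow> p2 (s e) = c (p e)"
    and ps': "\<And>e. e \<in> carrier E' \<Longrightarrow> p2' (s' e) = c (p' e)"
  defines "U \<equiv> \<lambda>A. \<Union>(e, e')\<in>A. baer_class L2 i2 E2 i2' E2' (s e) (s' e')"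
  shows baer_map_class: "e \<in> carrier E \<Longrightarrow> e' \<in> carrier E'
      \<Longrightarrow> U (baer_class L i E i' E' e e') = baer_class L2 i2 E2 i2' E2' (s e) (s' e')"
    and baer_map_hom: "U \<in> mod_hom R (baer_mod L i E p i' E' p') (baer_mod L2 i2 E2 p2 i2' E2' p2')"
proof -
  interpret D: baer R L E Q i p E' i' p' by fact
  interpret C: baer T L2 E2 Q2 i2 p2 E2' i2' p2' by fact
  note [simp] = mod_hom_closed[OF a] mod_hom_closed[OF s] mod_hom_closed[OF s']
  have U: "U (D.cls e e') = C.cls (s e) (s' e')" if e: "e \<in> carrier E" "e' \<in> carrier E'" for e e'
    unfolding U_def
  proof (rule D.UN_cls[OF e])
    fix m assume m: "m \<in> carrier L"
    have "s' (e' \<ominus>\<^bsub>E'\<^esub> i' m) = s' e' \<ominus>\<^bsub>E2'\<^esub> i2' (a m)"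
      using e m mod_hom_a_minus[OF s' D.Y.E.M.abelian_group_axioms C.Y.E.M.abelian_group_axioms]
      by (simp add: si')
    then show "C.cls (s (e \<oplus>\<^bsub>E\<^esub> i m)) (s' (e' \<ominus>\<^bsub>E'\<^esub> i' m)) = C.cls (s e) (s' e')"
      using e m by (simp add: mod_hom_add[OF s] si C.cls_shift)
  qed
  show "U (baer_class L i E i' E' e e') = baer_class L2 i2 E2 i2' E2' (s e) (s' e')"
    if "e \<in> carrier E" "e' \<in> carrier E'" using U that .
  show "U \<in> mod_hom R D.B C.B"
    using RT by (intro mod_homI)
      (auto elim!: D.B_cases simp: U D.B_add C.B_add D.B_smult C.B_smult ps ps' mod_hom_add[OF s]
        mod_hom_add[OF s'] mod_hom_smult[OF s] mod_hom_smult[OF s'] intro!: C.B_carrierI)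
qed

text \<open>
  If \<open>a\<close>, \<open>b\<close> and \<open>a'\<close>, \<open>b'\<close> are lifts for the two summands, then \<open>[a, a']\<close> and \<open>[b, b']\<close> are lifts for the sum,
  and \<open>\<tau> [b, b'] = [i p, i' q] + x\<^sup>n \<sigma> [a, a']\<close> with \<open>[i p, i' q] = [i (p + q), 0]\<close>.
\<close>

lemma baer_sum_twist_extension:
  assumes "twist_extension n F Z" "twist_extension n F W"
  shows "twist_extension n F (baer_sum F Z W)"
    and "p \<in> gluing_class F Z n \<Longrightarrow> q \<in> gluing_class F W n
      \<Longrightarrow> p \<oplus>\<^bsub>cmod F\<^esub> q \<in> gluing_class F (baer_sum F Z W) n"
proof -
  interpret Z: twist_extension n F Z by fact
  interpret W: twist_extension n F W by fact
  interpret l: baer poly_ring_x "lmod F" "lmod (mid Z)" "ring_as_module poly_ring_x" "lfun (inc Z)" "lfun (prj Z)"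
    "lmod (mid W)" "lfun (inc W)" "lfun (prj W)" ..
  interpret c: baer laurent_ring "cmod F" "cmod (mid Z)" "ring_as_module laurent_ring" "cfun (inc Z)" "cfun (prj Z)"
    "cmod (mid W)" "cfun (inc W)" "cfun (prj W)" ..
  interpret r: baer poly_ring_xinv "rmod F" "rmod (mid Z)" "ring_as_module poly_ring_xinv" "rfun (inc Z)" "rfun (prj Z)"
    "rmod (mid W)" "rfun (inc W)" "rfun (prj W)" ..
  let ?B = "baer_sum F Z W"
  have sel: "lmod (mid ?B) = l.B" "cmod (mid ?B) = c.B" "rmod (mid ?B) = r.B"
    "lfun (inc ?B) = l.iB" "cfun (inc ?B) = c.iB" "rfun (inc ?B) = r.iB"
    "lfun (prj ?B) = l.pB" "cfun (prj ?B) = c.pB" "rfun (prj ?B) = r.pB"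
    "sig (mid ?B) = (\<lambda>A. \<Union>(e, e')\<in>A. c.cls (sig (mid Z) e) (sig (mid W) e'))"
    "tau (mid ?B) = (\<lambda>A. \<Union>(e, e')\<in>A. c.cls (tau (mid Z) e) (tau (mid W) e'))"
    by (simp_all add: baer_sum_def baer_rep_def)
  have sig_hom: "sig (mid ?B) \<in> mod_hom poly_ring_x l.B c.B"
    unfolding sel
    by (rule baer_map_hom[OF l.baer_axioms c.baer_axioms _ Z.sig_F Z.sig_mid W.sig_mid])
      (simp_all add: Z.commute W.commute)
  have sig_cls: "sig (mid ?B) (l.cls e e') = c.cls (sig (mid Z) e) (sig (mid W) e')"
    if "e \<in> carrier (lmod (mid Z))" "e' \<in> carrier (lmod (mid W))" for e e'
    unfolding sel
    by (rule baer_map_class[OF l.baer_axioms c.baer_axioms _ Z.sig_F Z.sig_mid W.sig_mid])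
      (simp_all add: Z.commute W.commute that)
  have tau_hom: "tau (mid ?B) \<in> mod_hom poly_ring_xinv r.B c.B"
    unfolding sel
    by (rule baer_map_hom[OF r.baer_axioms c.baer_axioms _ Z.tau_F Z.tau_mid W.tau_mid, where c = "\<lambda>g. g * xpow n"])
      (simp_all add: Z.commute W.commute)
  have tau_cls: "tau (mid ?B) (r.cls e e') = c.cls (tau (mid Z) e) (tau (mid W) e')"
    if "e \<in> carrier (rmod (mid Z))" "e' \<in> carrier (rmod (mid W))" for e e'
    unfolding sel
    by (rule baer_map_class[OF r.baer_axioms c.baer_axioms _ Z.tau_F Z.tau_mid W.tau_mid, where c = "\<lambda>g. g * xpow n"])
      (simp_all add: Z.commute W.commute that)
  note [simp] = mod_hom_closed[OF Z.sig_mid] mod_hom_closed[OF Z.tau_mid] mod_hom_closed[OF Z.sig_F]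
    mod_hom_closed[OF W.sig_mid] mod_hom_closed[OF W.tau_mid] mod_hom_closed[OF Z.tau_F]
  have W0: "sig (mid W) \<zero>\<^bsub>lmod (mid W)\<^esub> = \<zero>\<^bsub>cmod (mid W)\<^esub>"
    "tau (mid W) \<zero>\<^bsub>rmod (mid W)\<^esub> = \<zero>\<^bsub>cmod (mid W)\<^esub>"
    using mod_hom_zero[OF W.sig_mid W.l.E.M.abelian_group_axioms W.c.E.M.abelian_group_axioms]
      mod_hom_zero[OF W.tau_mid W.r.E.M.abelian_group_axioms W.c.E.M.abelian_group_axioms] by simp_all
  have "is_ext (twist n) F ?B"
  proof (rule is_extI[OF Z.qcoh qcoh_twist])
    show "cfun (prj ?B) (sig (mid ?B) A) = sig (twist n) (lfun (prj ?B) A)"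
      if "A \<in> carrier (lmod (mid ?B))" for A
    proof -
      from that obtain e e' where "e \<in> carrier (lmod (mid Z))" "e' \<in> carrier (lmod (mid W))" "A = l.cls e e'"
        unfolding sel by (rule l.B_cases)
      then show ?thesis by (simp only: sig_cls) (simp add: sel c.pB_cls l.pB_cls Z.commute)
    qed
    show "cfun (prj ?B) (tau (mid ?B) A) = tau (twist n) (rfun (prj ?B) A)"
      if "A \<in> carrier (rmod (mid ?B))" for A
    proof -
      from that obtain e e' where "e \<in> carrier (rmod (mid Z))" "e' \<in> carrier (rmod (mid W))" "A = r.cls e e'"
        unfolding sel by (rule r.B_cases)
      then show ?thesis by (simp only: tau_cls) (simp add: sel c.pB_cls r.pB_cls Z.commute)
    qed
    show "cfun (inc ?B) (sig F m) = sig (mid ?B) (lfun (inc ?B) m)" if "m \<in> carrier (lmod F)" for m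
      using that unfolding sel(4,5) by (simp add: sig_cls Z.commute W0)
    show "cfun (inc ?B) (tau F m) = tau (mid ?B) (rfun (inc ?B) m)" if "m \<in> carrier (rmod F)" for m
      using that unfolding sel(5,6) by (simp add: tau_cls Z.commute W0)
  qed (use sig_hom tau_hom l.B_extension c.B_extension r.B_extension in \<open>simp_all add: sel\<close>)
  then show "twist_extension n F ?B" using Z.qcoh by unfold_locales
  show "p \<oplus>\<^bsub>cmod F\<^esub> q \<in> gluing_class F ?B n" if p: "p \<in> gluing_class F Z n" and q: "q \<in> gluing_class F W n"
  proof -
    from p obtain a b where pF: "p \<in> carrier (cmod F)"
      and a: "a \<in> carrier (lmod (mid Z))" "lfun (prj Z) a = 1"
      and b: "b \<in> carrier (rmod (mid Z))" "rfun (prj Z) b = 1"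
      and ab: "tau (mid Z) b = cfun (inc Z) p \<oplus>\<^bsub>cmod (mid Z)\<^esub> xpow n \<odot>\<^bsub>cmod (mid Z)\<^esub> sig (mid Z) a"
      by (auto elim!: gluing_classE)
    from q obtain a' b' where qF: "q \<in> carrier (cmod F)"
      and a': "a' \<in> carrier (lmod (mid W))" "lfun (prj W) a' = 1"
      and b': "b' \<in> carrier (rmod (mid W))" "rfun (prj W) b' = 1"
      and ab': "tau (mid W) b' = cfun (inc W) q \<oplus>\<^bsub>cmod (mid W)\<^esub> xpow n \<odot>\<^bsub>cmod (mid W)\<^esub> sig (mid W) a'"
      by (auto elim!: gluing_classE)
    have "tau (mid ?B) (r.cls b b') =
        c.cls (cfun (inc Z) p) (cfun (inc W) q) \<oplus>\<^bsub>c.B\<^esub> xpow n \<odot>\<^bsub>c.B\<^esub> sig (mid ?B) (l.cls a a')"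
      using pF qF a b a' b' by (simp add: tau_cls sig_cls c.B_add c.B_smult ab ab')
    also have "c.cls (cfun (inc Z) p) (cfun (inc W) q) = c.iB (p \<oplus>\<^bsub>cmod F\<^esub> q)"
      using pF qF by (rule c.cls_i_i')
    finally have *: "tau (mid ?B) (r.cls b b') =
        cfun (inc ?B) (p \<oplus>\<^bsub>cmod F\<^esub> q) \<oplus>\<^bsub>cmod (mid ?B)\<^esub> xpow n \<odot>\<^bsub>cmod (mid ?B)\<^esub> sig (mid ?B) (l.cls a a')"
      by (simp only: sel)
    show ?thesis
      using pF qF a b a' b' *
      by (intro gluing_classI[of _ _ "l.cls a a'" _ "r.cls b b'"])
        (simp_all add: sel(1,3,7,9) l.B_carrierI r.B_carrierI l.pB_cls r.pB_cls)
  qed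
qed

section \<open>The group of extensions\<close>

text \<open>
  The equivalence classes of extensions are the fibres of the gluing class, also
  those of extensions whose middle terms live in other types, such as split extensions and Baer sums.
\<close>

definition ext_fibre ::
  "int \<Rightarrow> ('k::field, 'm, 'p, 'n) rep \<Rightarrow> 'p set
    \<Rightarrow> ('k, 'm, 'p, 'n, 'a, 'b, 'c, 'k laurent, 'k laurent, 'k laurent) ext set" where
  "ext_fibre n F C = {W. is_ext (twist n) F W \<and> gluing_class F W n = C}"

lemma ext_class_eq_fibre:
  assumes "twist_extension n F Z"
  shows "ext_class (twist n) F Z = ext_fibre n F (gluing_class F Z n)"
  using assms ext_equiv_iff_gluing_class[OF _ assms]
  by (auto simp: ext_class_def ext_fibre_def twist_extension_def)

lemma trivial_quotient_iff:
  assumes "abelian_subgroup D P"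
  shows "trivial_group (P A_Mod D) \<longleftrightarrow> D = carrier P"
proof -
  interpret abelian_subgroup D P by fact
  have g: "group (P A_Mod D)" using a_factorgroup_is_comm_group comm_group.axioms(2) by blast
  have "carrier (P A_Mod D) = {D} \<longleftrightarrow> D = carrier P"
  proof
    assume eq: "carrier (P A_Mod D) = {D}"
    have "p \<in> D" if p: "p \<in> carrier P" for p
    proof -
      have "D +>\<^bsub>P\<^esub> p \<in> carrier (P A_Mod D)"
        using p by (auto simp: A_FactGroup_def' a_r_coset_def A_RCOSETS_def RCOSETS_def)
      then show ?thesis using a_rcos_self[OF p] eq by simp
    qed
    then show "D = carrier P" using a_subset by blast
  next
    assume D: "D = carrier P"
    have "D +>\<^bsub>P\<^esub> p = D" if "p \<in> D" for p
      using that a_coset_join2[OF _ a_subgroup that] a_subset by blast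
    then show "carrier (P A_Mod D) = {D}"
      using D by (auto simp: A_FactGroup_def' A_RCOSETS_def' intro!: bexI[of _ "\<zero>\<^bsub>P\<^esub>"])
  qed
  then show ?thesis using g by (simp add: trivial_group_def A_FactGroup_def')
qed


theorem proposition4p3:
  fixes F :: "('k::field, 'm, 'p, 'n) rep" and n :: int
  assumes "qcoh F"
    and "carrier (lmod F) \<times> carrier (lmod (\<O>(n) :: ('k, _, _, _) rep)) \<lesssim> (UNIV :: 'a set)"
    and "carrier (cmod F) \<times> carrier (cmod (\<O>(n) :: ('k, _, _, _) rep)) \<lesssim> (UNIV :: 'b set)"
    and "carrier (rmod F) \<times> carrier (rmod (\<O>(n) :: ('k, _, _, _) rep)) \<lesssim> (UNIV :: 'c set)"
  shows "comm_group (Ext1 TYPE('a \<times> 'b \<times> 'c) \<O>(n) F) \<and>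
    Ext1 TYPE('a \<times> 'b \<times> 'c) \<O>(n) F \<cong>
      cmod F A_Mod
        (((\<lambda>m. xpow n \<odot>\<^bsub>cmod F\<^esub> sig F m) ` carrier (lmod F)) <+>\<^bsub>cmod F\<^esub>
         (tau F ` carrier (rmod F))) \<and>
    (trivial_group (Ext1 TYPE('a \<times> 'b \<times> 'c) \<O>(n) F) \<longleftrightarrow>
      ((\<lambda>m. xpow n \<odot>\<^bsub>cmod F\<^esub> sig F m) ` carrier (lmod F)) <+>\<^bsub>cmod F\<^esub>
        (tau F ` carrier (rmod F)) = carrier (cmod F))"
proof -
  let ?D = "coboundaries n F"
  let ?Q = "cmod F A_Mod ?D"
  define X where "X = Ext1 TYPE('a \<times> 'b \<times> 'c) (twist n) F"
  define \<phi> :: "'p set \<Rightarrow> ('k, 'm, 'p, 'n, 'a, 'b, 'c, 'k laurent, 'k laurent, 'k laurent) ext set"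
    where "\<phi> = ext_fibre n F"
  interpret D: abelian_subgroup ?D "cmod F"
    by (rule coboundaries_abelian_subgroup[OF assms(1)])
  interpret Q: comm_group ?Q by (rule D.a_factorgroup_is_comm_group)
  have twist_ext: "twist_extension n F Z" if "is_ext (twist n) F Z" for
    Z :: "('k, 'm, 'p, 'n, 'a, 'b, 'c, 'k laurent, 'k laurent, 'k laurent) ext"
    using that assms(1) by unfold_locales
  have Q_carrier: "carrier ?Q = {?D +>\<^bsub>cmod F\<^esub> p | p. p \<in> carrier (cmod F)}"
    by (auto simp: A_FactGroup_def' A_RCOSETS_def')
  have realise: "\<exists>Z\<in>\<phi> C. is_ext (twist n) F Z \<and> gluing_class F Z n = C" if C: "C \<in> carrier ?Q" for C
  proof -
    obtain p where p: "p \<in> carrier (cmod F)" "C = ?D +>\<^bsub>cmod F\<^esub> p" using C Q_carrier by auto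
    obtain Z :: "('k, 'm, 'p, 'n, 'a, 'b, 'c, 'k laurent, 'k laurent, 'k laurent) ext"
      where Z: "twist_extension n F Z" "p \<in> gluing_class F Z n"
      by (rule gluing_class_surj[OF assms(1) p(1) assms(2-4)])
    then show ?thesis
      using p twist_extension.gluing_class_eq[OF Z] twist_extension.is_ext[OF Z(1)]
      by (auto simp: \<phi>_def ext_fibre_def)
  qed
  have class_mem: "gluing_class F Z n \<in> carrier ?Q" if Z: "is_ext (twist n) F Z" for
    Z :: "('k, 'm, 'p, 'n, 'a, 'b, 'c, 'k laurent, 'k laurent, 'k laurent) ext"
  proof -
    interpret twist_extension n F Z by (rule twist_ext[OF Z])
    obtain p where p: "p \<in> gluing_class F Z n" using gluing_class_nonempty by blast
    then have "p \<in> carrier (cmod F)" using gluing_class_subset by blast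
    then show ?thesis using gluing_class_eq[OF p] Q_carrier by blast
  qed
  have inj: "inj_on \<phi> (carrier ?Q)"
  proof (rule inj_onI)
    fix C C' assume "C \<in> carrier ?Q" and eq: "\<phi> C = \<phi> C'"
    then obtain Z where "Z \<in> \<phi> C" "gluing_class F Z n = C" using realise by blast
    moreover from this eq have "Z \<in> \<phi> C'" by simp
    ultimately show "C = C'" by (simp add: \<phi>_def ext_fibre_def)
  qed
  have X_carrier: "carrier X = \<phi> ` carrier ?Q"
  proof
    show "carrier X \<subseteq> \<phi> ` carrier ?Q"
      using class_mem ext_class_eq_fibre[OF twist_ext] by (auto simp: X_def Ext1_def \<phi>_def)
    show "\<phi> ` carrier ?Q \<subseteq> carrier X"
    proof
      fix A assume "A \<in> \<phi> ` carrier ?Q"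
      then obtain C where C: "C \<in> carrier ?Q" "A = \<phi> C" by blast
      then obtain Z where "is_ext (twist n) F Z" "gluing_class F Z n = C" "Z \<in> \<phi> C"
        using realise by blast
      then show "A \<in> carrier X"
        using C ext_class_eq_fibre[OF twist_ext] by (auto simp: X_def Ext1_def \<phi>_def)
    qed
  qed
  have mult: "\<phi> (C \<otimes>\<^bsub>?Q\<^esub> C') = \<phi> C \<otimes>\<^bsub>X\<^esub> \<phi> C'" if C: "C \<in> carrier ?Q" "C' \<in> carrier ?Q" for C C'
  proof -
    have "ext_class (twist n) F (baer_sum F Z W) = \<phi> (C \<otimes>\<^bsub>?Q\<^esub> C')" if "Z \<in> \<phi> C" "W \<in> \<phi> C'" for Z W
    proof -
      have Z: "twist_extension n F Z" "gluing_class F Z n = C"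
        and W: "twist_extension n F W" "gluing_class F W n = C'"
        using that twist_ext by (auto simp: \<phi>_def ext_fibre_def)
      obtain p q where pq: "p \<in> C" "q \<in> C'"
        using twist_extension.gluing_class_nonempty[OF Z(1)]
          twist_extension.gluing_class_nonempty[OF W(1)] Z(2) W(2) by blast
      have c: "p \<in> carrier (cmod F)" "q \<in> carrier (cmod F)"
        using pq Z W twist_extension.gluing_class_subset by blast+
      have B: "twist_extension n F (baer_sum F Z W)"
        "p \<oplus>\<^bsub>cmod F\<^esub> q \<in> gluing_class F (baer_sum F Z W) n"
        using baer_sum_twist_extension[OF Z(1) W(1)] pq Z(2) W(2) by auto
      \<comment> \<open>The gluing class of the Baer sum and the product of the two cosets both contain \<open>p + q\<close>.\<close>
      have "C = ?D +>\<^bsub>cmod F\<^esub> p" "C' = ?D +>\<^bsub>cmod F\<^esub> q"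
        using twist_extension.gluing_class_eq[OF Z(1), of p] twist_extension.gluing_class_eq[OF W(1), of q]
          pq Z(2) W(2) by simp_all
      then have "gluing_class F (baer_sum F Z W) n = C \<otimes>\<^bsub>?Q\<^esub> C'"
        using twist_extension.gluing_class_eq[OF B] D.a_rcos_sum[OF c] by (simp add: A_FactGroup_def')
      then show ?thesis using ext_class_eq_fibre[OF B(1)] by (simp add: \<phi>_def)
    qed
    then have "(\<Union>Z\<in>\<phi> C. \<Union>W\<in>\<phi> C'. ext_class (twist n) F (baer_sum F Z W)) = \<phi> (C \<otimes>\<^bsub>?Q\<^esub> C')"
      using realise[OF C(1)] realise[OF C(2)] by auto
    then show ?thesis by (simp add: X_def Ext1_def)
  qed
  have one: "\<phi> \<one>\<^bsub>?Q\<^esub> = \<one>\<^bsub>X\<^esub>"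
  proof -
    note S = split_ext_gluing_class[OF assms(1), of n]
    have "gluing_class F (split_ext (twist n) F) n = ?D"
      using twist_extension.gluing_class_eq[OF S] D.a_coset_add_zero D.a_subset by simp
    then show ?thesis
      by (simp add: X_def Ext1_def A_FactGroup_def' \<phi>_def ext_class_eq_fibre[OF S(1)])
  qed
  \<comment> \<open>The group structure on the set of classes is carried over from the quotient along \<open>\<phi>\<close>.\<close>
  have iso: "\<phi> \<in> iso ?Q X"
    using X_carrier inj mult by (auto simp: iso_def hom_def bij_betw_def)
  have X: "comm_group X" using Q.iso_imp_img_comm_group[OF iso] by (simp add: one)
  moreover have XQ: "X \<cong> ?Q" using iso Q.iso_sym by (auto simp: is_iso_def)
  moreover have "trivial_group X \<longleftrightarrow> ?D = carrier (cmod F)"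
    using isomorphic_group_triviality[OF XQ] comm_group.axioms(2)[OF X] Q.is_group
      trivial_quotient_iff[OF D.abelian_subgroup_axioms] by simp
  ultimately show ?thesis unfolding X_def coboundaries_def by blast
qed

end
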